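(* There exist a compact, porous set $P\subseteq\mathbb{R}^2$, a multiresolution family $\mathcal{F}$ for $P$, and a constant $A\geq1$ with the following property: for each coarse line field $\tau\colon\mathcal{F}_A\to\mathcal{L}_1$, there is a curve $\Gamma\subseteq P$ of finite length such that $$\sum_{\substack{B\in\mathcal{F}\\ \Gamma\cap B\neq\emptyset}}\beta^\tau_\Gamma(AB)^2\operatorname{diam}(B)=\infty.$$
   Context: A set $P\subseteq\mathbb{R}^2$ is porous if there is $\delta>0$ such that for every $x\in\mathbb{R}^2$ and $r>0$ there is $y\in B(x,r)$ with $B(y,\delta r)\cap P=\emptyset$. Balls $B(x,r)$ are closed, $AB$ is the ball with the same center as $B$ and $A$ times the radius, and $\mathcal{F}_A=\{AB:B\in\mathcal{F}\}$. Multiresolution family: a $\delta$-net in $P$ is a maximal $\delta$-separated subset of $P$. If $N_k\subseteq P$ ($k\in\mathbb{Z}$) are $2^{-k}$-nets in $P$ with $N_k\subseteq N_{k+1}$ for all $k$, the collection $\{B(z,2\cdot2^{-k}):k\in\mathbb{Z},z\in N_k\}$ is a multiresolution family for $P$. $\mathcal{L}_1$ is the collection of lines through the origin in $\mathbb{R}^2$; a coarse line field on $\mathcal{F}_A$ is an arbitrary map $\tau\colon\mathcal{F}_A\to\mathcal{L}_1$. For $D\in\mathcal{F}_A$ and $\Gamma\subseteq\mathbb{R}^2$, $$\beta^\tau_\Gamma(D)=\frac1{\operatorname{diam}(D)}\inf\Big\{\sup_{x\in\Gamma\cap D}\operatorname{dist}(x,L): L \text{ an affine line parallel to } \tau(D)\Big\}.$$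 A curve of finite length is a Lipschitz image of $[0,1]$. *)

theory Defs
  imports "HOL-Analysis.Analysis"
begin

text \<open>
  A closed ball is recorded as its pair (center, radius).  In the plane a closed ball of
  positive radius determines both, so for such balls this is the same as working with the
  underlying sets.
\<close>

type_synonym disc = "(real^2) \<times> real"

definition points :: "disc \<Rightarrow> (real^2) set" where
  "points B = cball (fst B) (snd B)"

definition dilate :: "real \<Rightarrow> disc \<Rightarrow> disc" where
  "dilate A B = (fst B, A * snd B)"

definition porous :: "(real^2) set \<Rightarrow> bool" where
  "porous P \<longleftrightarrow>
     (\<exists>\<delta>>0. \<forall>x. \<forall>r>0. \<exists>y \<in> cball x r. cball y (\<delta> * r) \<inter> P = {})"

definition separated :: "real \<Rightarrow> (real^2) set \<Rightarrow> bool" where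
  "separated \<delta> N \<longleftrightarrow> (\<forall>x\<in>N. \<forall>y\<in>N. x \<noteq> y \<longrightarrow> \<delta> \<le> dist x y)"

definition net_in :: "real \<Rightarrow> (real^2) set \<Rightarrow> (real^2) set \<Rightarrow> bool" where
  "net_in \<delta> P N \<longleftrightarrow> N \<subseteq> P \<and> separated \<delta> N \<and>
     (\<forall>M. N \<subseteq> M \<and> M \<subseteq> P \<and> separated \<delta> M \<longrightarrow> M = N)"

definition multiresolution_family :: "(real^2) set \<Rightarrow> disc set \<Rightarrow> bool" where
  "multiresolution_family P F \<longleftrightarrow>
     (\<exists>N :: int \<Rightarrow> (real^2) set.
        (\<forall>k. net_in (2 powi (- k)) P (N k)) \<and>
        (\<forall>k. N k \<subseteq> N (k + 1)) \<and>
        F = {(z, 2 * 2 powi (- k)) | z k. z \<in> N k})"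

definition lines_through_origin :: "(real^2) set set" where
  "lines_through_origin = {L. subspace L \<and> dim L = 1}"

definition coarse_line_field :: "disc set \<Rightarrow> (disc \<Rightarrow> (real^2) set) \<Rightarrow> bool" where
  "coarse_line_field G \<tau> \<longleftrightarrow> (\<forall>D\<in>G. \<tau> D \<in> lines_through_origin)"

definition lines_parallel_to :: "(real^2) set \<Rightarrow> (real^2) set set" where
  "lines_parallel_to T = {L. affine L \<and> aff_dim L = 1 \<and> affine_parallel L T}"

text \<open>The values lie in \<open>[0, \<infinity>]\<close>, so that every supremum and infimum exists; the
  supremum over the empty set is 0.\<close>

definition beta :: "(disc \<Rightarrow> (real^2) set) \<Rightarrow> (real^2) set \<Rightarrow> disc \<Rightarrow> ennreal" where
  "beta \<tau> \<Gamma> D =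
     (INF L\<in>lines_parallel_to (\<tau> D). SUP x\<in>\<Gamma> \<inter> points D. ennreal (infdist x L))
       / ennreal (diameter (points D))"

definition finite_length_curve :: "(real^2) set \<Rightarrow> bool" where
  "finite_length_curve \<Gamma> \<longleftrightarrow>
     (\<exists>(C::real) (f :: real \<Rightarrow> real^2). C-lipschitz_on {0..1} f \<and> \<Gamma> = f ` {0..1})"

end

theory Submission
  imports Defs
begin

text \<open>
  Two curves that leave a common point at an angle \<open>\<theta>\<close> stay within \<open>\<theta> l\<close> of each other over a
  length \<open>l\<close>.  At every dyadic scale between \<open>\<theta> l\<close> and \<open>l\<close>, which makes about \<open>log (1/\<theta>)\<close> of them,
  one and the same ball meets both, and a line field assigns to it a single direction, which is
  wrong by a multiple of \<open>\<theta>\<close> for one of the two curves.  So if a curve may decide, knowing the line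
  field, whether to bend by \<open>\<theta>\<close> or not, it can collect about \<open>\<theta>\<^sup>2 log (1/\<theta>)\<close> per unit length in
  the sum of the \<open>\<beta>\<^sup>2 diam\<close>, whereas bending back and forth by \<open>\<theta>\<close> costs only a factor
  \<open>1 + \<theta>\<^sup>2\<close> in length.  With angles \<open>\<theta>\<^sub>i\<close> such that \<open>\<Sum>\<theta>\<^sub>i\<^sup>2\<close> converges and
  \<open>\<Sum>\<theta>\<^sub>i\<^sup>2 log (1/\<theta>\<^sub>i)\<close> diverges, the length stays finite and the sum becomes infinite.

  The set is the closure of a union of graphs over \<open>[0,1]\<close>, one for each sequence of binary
  decisions.  If stage \<open>i\<close> decides to bend, then every cell of the dyadic grid of width
  \<open>l\<^sub>i = 2 ^ (- expo i)\<close> on which the current function has slope at most 1 receives a tent with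
  slopes \<open>\<plusminus>\<theta>\<^sub>i\<close>, and the whole graph is lifted by \<open>h\<^sub>i = \<theta>\<^sub>i l\<^sub>i\<close>.
  Restricting tents to gentle cells keeps all functions 2-Lipschitz, so that finite length is
  immediate.  Because a tent has mean slope 0, the mean square slope grows by at most \<open>\<theta>\<^sub>i\<^sup>2\<close> in
  stage \<open>i\<close> and never exceeds \<open>1/4\<close>; by Chebyshev at least three quarters of the cells are gentle
  at every stage (\<open>many_gentle_cells\<close>).
  The lift is what makes the set porous: two graphs whose first different decision is in stage
  \<open>j\<close> have vertical distance between \<open>h\<^sub>j / 2\<close> and \<open>2 h\<^sub>j\<close> at every point
  (\<open>profile_gaps\<close>), and the \<open>h\<^sub>j\<close> are lacunary, so every vertical interval contains
  a comparable one that is free of the set; the Lipschitz bound thickens it to a disc.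

  For a given line field the decisions are made one stage after the other.  Each decision is a
  single bit for the whole graph: summed over all balls of the stage, at least one of the two
  options has half of the total weight, and later stages change the graph too little to spoil
  this (\<open>stage_choice\<close>).
\<close>

section \<open>Angles, grids and heights of the stages\<close>

text \<open>
  \<open>lvl i\<close> is the integer part of \<open>log\<^sub>4 (i + 1)\<close>, and also the number of dyadic scales that stage
  \<open>i\<close> uses.  A block of \<open>3 * 4 ^ d\<close> stages shares the angle \<open>2 ^ (- d) / (d + 24)\<close>, so that
  it contributes \<open>3 / (d + 24)\<^sup>2\<close> to \<open>\<Sum>\<theta>\<^sup>2\<close> and \<open>3 d / (d + 24)\<^sup>2\<close> to the sum of the
  \<open>\<theta>\<^sup>2\<close> weighted by the number of scales: a convergent and a divergent series.  The 24 makes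
  the first series small and leaves \<open>d\<close> full scales between \<open>h\<^sub>i\<close> and the cell width.
\<close>
definition lvl :: "nat \<Rightarrow> nat" where
  "lvl i = (LEAST d. i + 1 < 4 ^ Suc d)"

definition angle :: "nat \<Rightarrow> real" where
  "angle i = 1 / (2 ^ lvl i * (lvl i + 24))"

definition expo :: "nat \<Rightarrow> nat" where
  "expo i = (\<Sum>j<i. 4 * lvl j + 20)"

definition height :: "nat \<Rightarrow> real" where
  "height i = angle i / 2 ^ expo i"

lemma lvl_eqI:
  assumes "4 ^ d \<le> i + 1" "i + 1 < 4 ^ Suc d"
  shows "lvl i = d"
  unfolding lvl_def
proof (rule Least_equality)
  fix e assume e: "i + 1 < 4 ^ Suc e"
  show "d \<le> e"
  proof (rule ccontr)
    assume "\<not> d \<le> e"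
    then have "(4::nat) ^ Suc e \<le> 4 ^ d" by (intro power_increasing) auto
    then show False using e assms by linarith
  qed
qed (use assms in auto)

lemma sum_by_lvl: "(\<Sum>i<4 ^ D - 1. g (lvl i)) = (\<Sum>d<D. 3 * 4 ^ d * (g d :: real))"
proof (induction D)
  case (Suc D)
  define M :: nat where "M = 4 ^ D - 1"
  define M' :: nat where "M' = 4 ^ Suc D - 1"
  have M1: "4 ^ D = M + 1" "4 ^ Suc D = M' + 1" by (auto simp: M_def M'_def)
  have "real M' = real M + 3 * 4 ^ D"
    using arg_cong[OF M1(1), of real] arg_cong[OF M1(2), of real] by simp
  moreover have le: "M \<le> M'" using M1 by simp
  ultimately have card: "real (M' - M) = 3 * 4 ^ D" by simp
  have "(\<Sum>i<M'. g (lvl i)) = (\<Sum>i<M. g (lvl i)) + (\<Sum>i=M..<M'. g (lvl i))"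
    using sum.atLeastLessThan_concat[of 0 M M' "\<lambda>i. g (lvl i)"] le
    by (simp add: lessThan_atLeast0)
  also have "(\<Sum>i=M..<M'. g (lvl i)) = (\<Sum>i=M..<M'. g D)"
    by (intro sum.cong refl arg_cong[where f=g] lvl_eqI) (use M1 in auto)
  also have "\<dots> = 3 * 4 ^ D * g D" by (simp add: card)
  finally show ?case using Suc by (simp add: M_def M'_def)
qed auto

lemma angle_pos: "0 < angle i"
  by (auto simp: angle_def intro!: divide_pos_pos mult_pos_pos)

lemma angle_mult_pow: "angle i * 2 ^ lvl i \<le> 1 / 24"
  by (simp add: angle_def divide_simps)

lemma angle_le: "angle i \<le> 1 / 24"
proof -
  have "angle i * 1 \<le> angle i * 2 ^ lvl i"
    using angle_pos[of i] by (intro mult_left_mono) auto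
  then show ?thesis using angle_mult_pow[of i] by linarith
qed

lemma four_pow: "(4::real) ^ d = 2 ^ d * 2 ^ d"
  by (simp flip: power_mult_distrib)

lemma sum_angle_sq_le: "(\<Sum>i<N. (angle i)\<^sup>2) \<le> 1 / 4"
proof -
  have "N + 1 \<le> 4 ^ N" by (induction N) auto
  then have N: "{..<N} \<subseteq> {..<4 ^ N - 1}" by auto
  \<comment> \<open>telescoping bound, with \<open>1 / m\<^sup>2 \<le> 1 / (m - 1) - 1 / m\<close>\<close>
  have *: "(\<Sum>d<D. 3 / (real d + 24)\<^sup>2) \<le> 3 / 23 - 3 / (real D + 23)" for D
  proof (induction D)
    case (Suc D)
    have "3 / (real D + 24)\<^sup>2 \<le> 3 / (real D + 23) - 3 / (real (Suc D) + 23)"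
      by (simp add: divide_simps power2_eq_square) (simp add: algebra_simps)
    then show ?case using Suc by simp
  qed auto
  have "(\<Sum>i<N. (angle i)\<^sup>2) \<le> (\<Sum>i<4 ^ N - 1. (angle i)\<^sup>2)"
    by (rule sum_mono2) (use N in auto)
  also have "\<dots> = (\<Sum>i<4 ^ N - 1. (\<lambda>d. (1 / (2 ^ d * (real d + 24)))\<^sup>2) (lvl i))"
    by (simp add: angle_def add.commute)
  also have "\<dots> = (\<Sum>d<N. 3 * 4 ^ d * (1 / (2 ^ d * (real d + 24)))\<^sup>2)"
    by (rule sum_by_lvl)
  also have "\<dots> = (\<Sum>d<N. 3 / (real d + 24)\<^sup>2)"
    by (intro sum.cong refl)
      (simp add: four_pow power2_eq_square)
  also have "\<dots> \<le> 3 / 23 - 3 / (real N + 23)" by (rule *)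
  also have "\<dots> \<le> 1 / 4" by (simp add: field_simps)
  finally show ?thesis .
qed

lemma sum_lvl_angle_sq_unbounded: "\<exists>N. C \<le> (\<Sum>i<N. lvl i * (angle i)\<^sup>2)"
proof (rule ccontr)
  assume "\<nexists>N. C \<le> (\<Sum>i<N. lvl i * (angle i)\<^sup>2)"
  then have bd: "(\<Sum>i<N. lvl i * (angle i)\<^sup>2) \<le> C" for N
    by (meson linear)
  have "summable (\<lambda>d. 3 * real d / (real d + 24)\<^sup>2)"
  proof (rule summableI_nonneg_bounded)
    fix D
    have "(\<Sum>i<4 ^ D - 1. lvl i * (angle i)\<^sup>2)
        = (\<Sum>i<4 ^ D - 1. (\<lambda>d. d * (1 / (2 ^ d * (real d + 24)))\<^sup>2) (lvl i))"
      by (simp add: angle_def add.commute)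
    also have "\<dots> = (\<Sum>d<D. 3 * 4 ^ d * (d * (1 / (2 ^ d * (real d + 24)))\<^sup>2))"
      by (rule sum_by_lvl)
    also have "\<dots> = (\<Sum>d<D. 3 * real d / (real d + 24)\<^sup>2)"
      by (intro sum.cong refl)
        (simp add: four_pow power2_eq_square)
    finally show "(\<Sum>d<D. 3 * real d / (real d + 24)\<^sup>2) \<le> C" using bd by metis
  qed auto
  moreover have "norm (3 / 625 * inverse (real d)) \<le> 3 * real d / (real d + 24)\<^sup>2" for d
  proof (cases "d = 0")
    case False
    then have "real d + 24 \<le> 25 * d" by simp
    then have "(real d + 24)\<^sup>2 \<le> (25 * real d)\<^sup>2" by (intro power_mono) auto
    then have "3 * real d / (25 * real d)\<^sup>2 \<le> 3 * real d / (real d + 24)\<^sup>2"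
      by (intro divide_left_mono) (use False in auto)
    moreover have "3 * real d / (25 * real d)\<^sup>2 = norm (3 / 625 * inverse (real d))"
      using False by (simp add: field_simps power2_eq_square)
    ultimately show ?thesis by simp
  qed auto
  ultimately have "summable (\<lambda>d. 3 / 625 * inverse (real d))"
    by (rule summable_comparison_test'[where N=0])
  then have "summable (\<lambda>d. inverse (real d))"
    by (subst (asm) summable_cmult_iff) auto
  then show False using not_summable_harmonic[where 'a=real] by simp
qed

text \<open>The grids are refined so fast that everything added after stage \<open>i\<close> is small compared with
  \<open>\<theta>\<^sub>i h\<^sub>i\<close>, the precision to which the direction of the curve matters at the smallest scale
  of stage \<open>i\<close>.\<close>
lemma cell_shrink: "1 / 2 ^ expo (Suc i) \<le> (angle i)\<^sup>2 / 2 ^ expo i / 200"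
proof -
  define d where "d = lvl i"
  have "real d < 2 ^ d" by (rule of_nat_less_two_power)
  then have "real d + 24 \<le> 32 * 2 ^ d"
    by (smt (verit) one_le_power)
  then have "2 ^ d * (real d + 24) \<le> 2 ^ d * (32 * 2 ^ d)" by simp
  then have "1 / (2 ^ d * (32 * 2 ^ d)) \<le> angle i"
    unfolding angle_def d_def[symmetric] by (intro divide_left_mono) (auto simp: add.commute)
  then have "(1 / (2 ^ d * (32 * 2 ^ d)))\<^sup>2 \<le> (angle i)\<^sup>2" by (intro power_mono) auto
  moreover have "(1 / (2 ^ d * (32 * 2 ^ d)))\<^sup>2 = 1024 / (2::real) ^ (4 * d + 20)"
    by (simp add: power2_eq_square power_add power_mult divide_simps flip: power_mult_distrib)
  ultimately have "1024 / (2::real) ^ (4 * d + 20) \<le> (angle i)\<^sup>2" by simp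
  then have "200 / 2 ^ (4 * d + 20) \<le> (angle i)\<^sup>2"
    by (rule order_trans[rotated]) (intro divide_right_mono, auto)
  then have "(200 / 2 ^ (4 * d + 20)) / (200 * 2 ^ expo i) \<le> (angle i)\<^sup>2 / (200 * 2 ^ expo i)"
    by (intro divide_right_mono) auto
  then show ?thesis
    by (simp add: expo_def power_add d_def field_simps)
qed

lemma height_pos: "0 < height i"
  by (simp add: height_def angle_pos)

lemma height_Suc_le: "height (Suc i) \<le> (angle i)\<^sup>2 / 2 ^ expo i / 200"
proof -
  have "height (Suc i) \<le> 1 / 2 ^ expo (Suc i)"
    unfolding height_def using angle_le[of "Suc i"] by (intro divide_right_mono) auto
  then show ?thesis using cell_shrink[of i] by linarith
qed

lemma height_Suc: "200 * height (Suc i) \<le> height i"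
proof -
  have "(angle i)\<^sup>2 \<le> angle i * 1"
    using angle_pos[of i] angle_le[of i] by (simp add: power2_eq_square)
  then have "(angle i)\<^sup>2 / 2 ^ expo i \<le> angle i / 2 ^ expo i"
    by (intro divide_right_mono) auto
  then show ?thesis using height_Suc_le[of i] by (simp add: height_def)
qed

lemma height_separated: "i < j \<Longrightarrow> 200 * height j \<le> height i"
proof (induction j)
  case (Suc j)
  have "200 * height (Suc j) \<le> height j" "0 < height j"
    using height_Suc height_pos by auto
  then show ?case using Suc by (cases "i = j") (auto simp: less_Suc_eq)
qed auto

text \<open>Stage \<open>i\<close> works with the balls of radius \<open>2 / 2 ^ k\<close> for \<open>lvl i\<close> consecutive
  exponents \<open>k\<close> starting at \<open>expo i + 3\<close>; hence no ball is counted in two stages.\<close>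
lemma scale_ranges_disjoint:
  assumes "i < j"
  shows "expo i + lvl i < expo j"
proof -
  have "expo (Suc i) \<le> expo j"
    unfolding expo_def using assms by (intro sum_mono2) auto
  then show ?thesis by (simp add: expo_def)
qed

section \<open>Adding tents to piecewise affine functions\<close>

definition cell :: "nat \<Rightarrow> nat \<Rightarrow> real set" where
  "cell n q = {q / 2 ^ n .. (q + 1) / 2 ^ n}"

definition has_slopes :: "nat \<Rightarrow> (real \<Rightarrow> real) \<Rightarrow> (nat \<Rightarrow> real) \<Rightarrow> bool" where
  "has_slopes n \<phi> \<sigma> \<longleftrightarrow>
     (\<forall>q<2 ^ n. \<forall>x\<in>cell n q. \<phi> x = \<phi> (q / 2 ^ n) + \<sigma> q * (x - q / 2 ^ n))"

text \<open>The grid cell of a point is found with the floor function, which puts a common end point into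
  the cell on its right.  Tents vanish at both ends of a cell, so this choice does not affect
  continuity.\<close>
definition bump :: "nat \<Rightarrow> (real \<Rightarrow> real) \<Rightarrow> real \<Rightarrow> real" where
  "bump i \<phi> x =
     (let n = expo i; q = nat \<lfloor>x * 2 ^ n\<rfloor>; a = q / 2 ^ n; b = (q + 1) / 2 ^ n
      in height i + (if \<bar>(\<phi> b - \<phi> a) * 2 ^ n\<bar> \<le> 1 then angle i * min (x - a) (b - x) else 0))"

definition step :: "nat \<Rightarrow> bool \<Rightarrow> (real \<Rightarrow> real) \<Rightarrow> real \<Rightarrow> real" where
  "step i b \<phi> x = (if b then \<phi> x + bump i \<phi> x else \<phi> x)"

definition tame :: "nat \<Rightarrow> real \<Rightarrow> (real \<Rightarrow> real) \<Rightarrow> bool" where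
  "tame n e \<phi> \<longleftrightarrow>
     (\<exists>\<sigma>. has_slopes n \<phi> \<sigma> \<and> (\<forall>q. \<bar>\<sigma> q\<bar> \<le> 2) \<and> (\<Sum>q<2 ^ n. (\<sigma> q)\<^sup>2) \<le> e * 2 ^ n)"

lemma has_slopesD:
  "has_slopes n \<phi> \<sigma> \<Longrightarrow> q < 2 ^ n \<Longrightarrow> x \<in> cell n q \<Longrightarrow>
    \<phi> x = \<phi> (q / 2 ^ n) + \<sigma> q * (x - q / 2 ^ n)"
  by (auto simp: has_slopes_def)

lemma bump_on_cell:
  assumes "has_slopes (expo i) \<phi> \<sigma>" "q < 2 ^ expo i" "x \<in> cell (expo i) q"
  shows "bump i \<phi> x = height i +
    (if \<bar>\<sigma> q\<bar> \<le> 1 then angle i * min (x - q / 2 ^ expo i) ((q + 1) / 2 ^ expo i - x) else 0)"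
proof (cases "x = (q + 1) / 2 ^ expo i")
  case True
  then have "nat \<lfloor>x * 2 ^ expo i\<rfloor> = q + 1" by simp
  then show ?thesis
    using True by (simp add: bump_def Let_def field_simps)
next
  case False
  then have x: "real q \<le> x * 2 ^ expo i" "x * 2 ^ expo i < real q + 1"
    using assms(3) by (auto simp: cell_def field_simps)
  then have "\<lfloor>x * 2 ^ expo i\<rfloor> = int q" by (intro floor_unique) auto
  moreover have "(\<phi> ((q + 1) / 2 ^ expo i) - \<phi> (q / 2 ^ expo i)) * 2 ^ expo i = \<sigma> q"
  proof -
    have "\<phi> ((q + 1) / 2 ^ expo i)
        = \<phi> (q / 2 ^ expo i) + \<sigma> q * ((q + 1) / 2 ^ expo i - q / 2 ^ expo i)"
      using assms(1,2) by (rule has_slopesD) (auto simp: cell_def divide_right_mono)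
    then show ?thesis by (simp add: add_divide_distrib)
  qed
  ultimately show ?thesis by (simp add: bump_def Let_def add.commute)
qed

lemma bump_bounds:
  assumes "0 \<le> x"
  shows "height i \<le> bump i \<phi> x" "bump i \<phi> x \<le> 3 / 2 * height i"
proof -
  define q where "q = nat \<lfloor>x * 2 ^ expo i\<rfloor>"
  have "real q \<le> x * 2 ^ expo i" "x * 2 ^ expo i < real q + 1"
    using assms by (auto simp: q_def)
  then have l: "q / 2 ^ expo i \<le> x" "x \<le> (real q + 1) / 2 ^ expo i"
    by (auto simp: field_simps)
  define t where "t = min (x - q / 2 ^ expo i) ((real q + 1) / 2 ^ expo i - x)"
  have t: "0 \<le> t" "2 * t \<le> 1 / 2 ^ expo i"
    using l by (auto simp: t_def add_divide_distrib min_def)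
  have "0 \<le> angle i * t" using t angle_pos[of i] by auto
  moreover have "angle i * (2 * t) \<le> angle i * (1 / 2 ^ expo i)"
    by (rule mult_left_mono) (use t angle_pos[of i] in auto)
  ultimately have "0 \<le> angle i * t" "angle i * t \<le> height i / 2"
    by (auto simp: height_def)
  then show "height i \<le> bump i \<phi> x" "bump i \<phi> x \<le> 3 / 2 * height i"
    using height_pos[of i]
    by (auto simp: bump_def Let_def q_def[symmetric] t_def[symmetric] add.commute[of 1])
qed

lemma sum_pairs: "(\<Sum>q<2 * N. g q) = (\<Sum>q<N. g (2 * q) + g (2 * q + 1) :: real)" for N :: nat
  by (induction N) (auto simp: algebra_simps)

text \<open>The two halves of a cell are the cells of the next grid.  On the left half the distance to the
  left end is the smaller one, on the right half the distance to the right end, so that each half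
  sees one side of a tent.\<close>
lemma cell_Suc:
  assumes "x \<in> cell (Suc n) q"
  shows "x \<in> cell n (q div 2)"
    and "even q \<Longrightarrow> q / 2 ^ Suc n = (q div 2) / 2 ^ n \<and> x - (q div 2) / 2 ^ n \<le> ((q div 2) + 1) / 2 ^ n - x"
    and "odd q \<Longrightarrow> q / 2 ^ Suc n = ((q div 2) + 1 / 2) / 2 ^ n
           \<and> ((q div 2) + 1) / 2 ^ n - x \<le> x - (q div 2) / 2 ^ n"
proof -
  consider p where "q = 2 * p" | p where "q = 2 * p + 1" by (meson evenE oddE)
  then show "x \<in> cell n (q div 2)"
    using assms by cases (auto simp: cell_def field_simps)
  show "q / 2 ^ Suc n = (q div 2) / 2 ^ n \<and> x - (q div 2) / 2 ^ n \<le> ((q div 2) + 1) / 2 ^ n - x"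
    if ev: "even q"
  proof -
    obtain p where p: "q = 2 * p" using ev by blast
    have mid: "(real q + 1) / 2 ^ Suc n = (real p / 2 ^ n + (real p + 1) / 2 ^ n) / 2"
      by (simp add: p field_simps)
    have "x \<le> (real q + 1) / 2 ^ Suc n" using assms by (simp add: cell_def add.commute[of 1])
    then show ?thesis unfolding mid by (simp add: p add.commute[of 1])
  qed
  show "q / 2 ^ Suc n = ((q div 2) + 1 / 2) / 2 ^ n \<and> ((q div 2) + 1) / 2 ^ n - x \<le> x - (q div 2) / 2 ^ n"
    if od: "odd q"
  proof -
    obtain p where p: "q = 2 * p + 1" using od by (elim oddE)
    have mid: "real q / 2 ^ Suc n = (real p / 2 ^ n + (real p + 1) / 2 ^ n) / 2"
      and half: "real q / 2 ^ Suc n = (real p + 1 / 2) / 2 ^ n"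
      by (simp_all add: p field_simps)
    have "real q / 2 ^ Suc n \<le> x" using assms by (simp add: cell_def)
    then have "(real p + 1) / 2 ^ n - x \<le> x - real p / 2 ^ n" unfolding mid by simp
    then show ?thesis using half by (simp add: p add.commute[of 1])
  qed
qed

lemma cell_left: "q / 2 ^ n \<in> cell n q"
  by (simp add: cell_def divide_right_mono)

lemma has_slopes_refine:
  assumes "has_slopes n \<phi> \<sigma>"
  shows "has_slopes (Suc n) \<phi> (\<lambda>q. \<sigma> (q div 2))"
  unfolding has_slopes_def
proof (intro allI impI ballI)
  fix q x assume q: "q < 2 ^ Suc n" and x: "x \<in> cell (Suc n) q"
  have "q div 2 < 2 ^ n" using q by auto
  note * = has_slopesD[OF assms this]
  show "\<phi> x = \<phi> (q / 2 ^ Suc n) + \<sigma> (q div 2) * (x - q / 2 ^ Suc n)"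
    using *[OF cell_Suc(1)[OF x]] *[OF cell_Suc(1)[OF cell_left]]
    by (simp add: algebra_simps)
qed

lemma has_slopes_bump:
  assumes "has_slopes (expo i) \<phi> \<sigma>"
  shows "has_slopes (Suc (expo i)) (\<lambda>x. \<phi> x + bump i \<phi> x)
    (\<lambda>q. \<sigma> (q div 2) +
      (if \<bar>\<sigma> (q div 2)\<bar> \<le> 1 then if even q then angle i else - angle i else 0))"
  (is "has_slopes _ ?\<psi> ?\<sigma>")
  unfolding has_slopes_def
proof (intro allI impI ballI)
  fix q x assume q: "q < 2 ^ Suc (expo i)" and x: "x \<in> cell (Suc (expo i)) q"
  let ?a = "real q / 2 ^ Suc (expo i)"
  have q': "q div 2 < 2 ^ expo i" using q by auto
  note a = cell_left[of q "Suc (expo i)"]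
  have \<phi>: "\<phi> x = \<phi> ?a + \<sigma> (q div 2) * (x - ?a)"
    using has_slopesD[OF has_slopes_refine[OF assms] q x] .
  note bx = bump_on_cell[OF assms q' cell_Suc(1)[OF x]]
  note ba = bump_on_cell[OF assms q' cell_Suc(1)[OF a]]
  have "bump i \<phi> x = bump i \<phi> ?a +
      (if \<bar>\<sigma> (q div 2)\<bar> \<le> 1 then if even q then angle i else - angle i else 0) * (x - ?a)"
  proof (cases "even q")
    case True
    then show ?thesis
      using cell_Suc(2)[OF x True] cell_Suc(2)[OF a True]
      unfolding bx ba by (auto simp: min_absorb1 algebra_simps)
  next
    case False
    then show ?thesis
      using cell_Suc(3)[OF x False] cell_Suc(3)[OF a False]
      unfolding bx ba by (auto simp: min_absorb2 algebra_simps add_divide_distrib diff_divide_distrib)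
  qed
  then show "?\<psi> x = ?\<psi> ?a + ?\<sigma> q * (x - ?a)"
    using \<phi> by (simp add: algebra_simps)
qed

lemma tame_refine:
  assumes "tame n e \<phi>" "n \<le> n'"
  shows "tame n' e \<phi>"
  using assms(2,1)
proof (induction n' rule: dec_induct)
  case (step m)
  then obtain \<sigma> where \<sigma>: "has_slopes m \<phi> \<sigma>" "\<And>q. \<bar>\<sigma> q\<bar> \<le> 2" "(\<Sum>q<2 ^ m. (\<sigma> q)\<^sup>2) \<le> e * 2 ^ m"
    by (auto simp: tame_def)
  have "(\<Sum>q<2 ^ Suc m. (\<sigma> (q div 2))\<^sup>2) = 2 * (\<Sum>q<2 ^ m. (\<sigma> q)\<^sup>2)"
    by (simp add: sum_pairs sum_distrib_left)
  then show ?case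
    unfolding tame_def using has_slopes_refine[OF \<sigma>(1)] \<sigma>(2,3) by (intro exI[of _ "\<lambda>q. \<sigma> (q div 2)"]) auto
qed

text \<open>On the two halves of a gentle cell the slope \<open>s\<close> becomes \<open>s + \<theta>\<close> and \<open>s - \<theta>\<close>, and
  \<open>(s + \<theta>)\<^sup>2 + (s - \<theta>)\<^sup>2 = 2 s\<^sup>2 + 2 \<theta>\<^sup>2\<close>: the mixed terms cancel, so squares of angles add
  up although angles do not.  The bound 2 persists because only slopes of size at most 1 change.\<close>
lemma tame_step:
  assumes "tame (expo i) e \<phi>"
  shows "tame (expo (Suc i)) (e + (angle i)\<^sup>2) (step i b \<phi>)"
proof -
  have le: "Suc (expo i) \<le> expo (Suc i)" by (simp add: expo_def)
  obtain \<sigma> where \<sigma>: "has_slopes (expo i) \<phi> \<sigma>" "\<And>q. \<bar>\<sigma> q\<bar> \<le> 2"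
    "(\<Sum>q<2 ^ expo i. (\<sigma> q)\<^sup>2) \<le> e * 2 ^ expo i"
    using assms by (auto simp: tame_def)
  define \<sigma>' where "\<sigma>' = (\<lambda>q. \<sigma> (q div 2) +
      (if \<bar>\<sigma> (q div 2)\<bar> \<le> 1 then if even q then angle i else - angle i else 0))"
  show ?thesis
  proof (cases b)
    case True
    have "(\<Sum>q<2 ^ Suc (expo i). (\<sigma>' q)\<^sup>2)
        = (\<Sum>q<2 ^ expo i. 2 * (\<sigma> q)\<^sup>2 + 2 * (if \<bar>\<sigma> q\<bar> \<le> 1 then (angle i)\<^sup>2 else 0))"
      by (simp add: sum_pairs \<sigma>'_def)
        (auto intro!: sum.cong simp: power2_eq_square algebra_simps)
    also have "\<dots> \<le> (\<Sum>q<2 ^ expo i. 2 * (\<sigma> q)\<^sup>2 + 2 * (angle i)\<^sup>2)"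
      by (intro sum_mono) auto
    also have "\<dots> \<le> (e + (angle i)\<^sup>2) * 2 ^ Suc (expo i)"
      using \<sigma>(3) by (simp add: sum.distrib algebra_simps flip: sum_distrib_left)
    finally have "(\<Sum>q<2 ^ Suc (expo i). (\<sigma>' q)\<^sup>2) \<le> (e + (angle i)\<^sup>2) * 2 ^ Suc (expo i)" .
    moreover have "\<bar>\<sigma>' q\<bar> \<le> 2" for q
      using \<sigma>(2)[of "q div 2"] angle_le[of i] angle_pos[of i] by (auto simp: \<sigma>'_def)
    moreover have "has_slopes (Suc (expo i)) (step i b \<phi>) \<sigma>'"
      using has_slopes_bump[OF \<sigma>(1)] True by (simp add: step_def[abs_def] \<sigma>'_def)
    ultimately have "tame (Suc (expo i)) (e + (angle i)\<^sup>2) (step i b \<phi>)"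
      unfolding tame_def by blast
    then show ?thesis using le by (rule tame_refine)
  next
    case False
    have "e * 2 ^ expo i \<le> (e + (angle i)\<^sup>2) * 2 ^ expo i"
      by (intro mult_right_mono) auto
    then have "tame (expo i) (e + (angle i)\<^sup>2) \<phi>"
      unfolding tame_def using \<sigma> by (meson order_trans)
    then show ?thesis
      using le False tame_refine[of "expo i" _ \<phi> "expo (Suc i)"] by (simp add: step_def[abs_def])
  qed
qed

lemma tame_lipschitz:
  assumes "tame n e \<phi>"
  shows "2-lipschitz_on {0..1} \<phi>"
proof -
  obtain \<sigma> where \<sigma>: "has_slopes n \<phi> \<sigma>" "\<And>q. \<bar>\<sigma> q\<bar> \<le> 2"
    using assms by (auto simp: tame_def)
  show ?thesis
  proof (rule lipschitz_on_closed_Union[where I = "{..<2 ^ n}" and U = "cell n"])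
    fix q :: nat assume q: "q \<in> {..<2 ^ n}"
    show "2-lipschitz_on (cell n q) \<phi>"
    proof (rule lipschitz_onI)
      fix x y assume "x \<in> cell n q" "y \<in> cell n q"
      then have "\<phi> x - \<phi> y = \<sigma> q * (x - y)"
        using has_slopesD[OF \<sigma>(1), of q x] has_slopesD[OF \<sigma>(1), of q y] q
        by (simp add: algebra_simps)
      then show "dist (\<phi> x) (\<phi> y) \<le> 2 * dist x y"
        using \<sigma>(2)[of q] by (simp add: dist_real_def abs_mult mult_right_mono)
    qed auto
    show "closed (cell n q)" by (simp add: cell_def)
  next
    show "{0..1} \<subseteq> (\<Union>q\<in>{..<2 ^ n}. cell n q)"
    proof
      fix x :: real assume x: "x \<in> {0..1}"
      show "x \<in> (\<Union>q\<in>{..<2 ^ n}. cell n q)"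
      proof (cases "x = 1")
        case True
        then have "x \<in> cell n (2 ^ n - 1)" by (simp add: cell_def of_nat_diff field_simps)
        then show ?thesis by (intro UN_I[of "2 ^ n - 1"]) auto
      next
        case False
        define q where "q = nat \<lfloor>x * 2 ^ n\<rfloor>"
        have q: "real q \<le> x * 2 ^ n" "x * 2 ^ n < real q + 1"
          using x by (auto simp: q_def)
        have "x * 2 ^ n < 1 * 2 ^ n" using False x by (intro mult_strict_right_mono) auto
        then have "real q < 2 ^ n" using q(1) by linarith
        then have "real q < real (2 ^ n)" by simp
        then have "q < 2 ^ n" by (simp only: of_nat_less_iff)
        moreover have "x \<in> cell n q" using q by (simp add: cell_def field_simps)
        ultimately show ?thesis by blast
      qed
    qed
  qed auto
qed

section \<open>The limit functions\<close>

primrec approx :: "(nat \<Rightarrow> bool) \<Rightarrow> nat \<Rightarrow> real \<Rightarrow> real" where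
  "approx w 0 = (\<lambda>x. 0)"
| "approx w (Suc i) = step i (w i) (approx w i)"

definition profile :: "(nat \<Rightarrow> bool) \<Rightarrow> real \<Rightarrow> real" where
  "profile w x = lim (\<lambda>i. approx w i x)"

lemma tame_approx: "tame (expo i) (\<Sum>j<i. (angle j)\<^sup>2) (approx w i)"
proof (induction i)
  case 0
  show ?case
    by (auto simp: tame_def has_slopes_def intro!: exI[of _ "\<lambda>q. 0"])
next
  case (Suc i)
  from tame_step[OF this] show ?case by simp
qed

lemma approx_cong: "(\<And>j. j < i \<Longrightarrow> w j = w' j) \<Longrightarrow> approx w i = approx w' i"
  by (induction i) auto

lemma approx_tail:
  assumes "0 \<le> x" "i \<le> j"
  shows "approx w i x \<le> approx w j x"
    "approx w j x \<le> approx w i x + 2 * height i - 2 * height j"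
  using assms(2)
proof (induction j rule: dec_induct)
  case (step j)
  { case 1 then show ?case
      using step bump_bounds[OF assms(1), of j "approx w j"] height_pos[of j]
      by (auto simp: step_def) }
  { case 2 then show ?case
      using step bump_bounds[OF assms(1), of j "approx w j"] height_pos[of j] height_Suc[of j]
      by (auto simp: step_def) }
qed auto

lemma approx_tendsto:
  assumes "0 \<le> x"
  shows "(\<lambda>i. approx w i x) \<longlonglongrightarrow> profile w x"
proof -
  have "incseq (\<lambda>i. approx w i x)"
    using approx_tail(1)[OF assms] by (auto simp: incseq_def)
  moreover have "\<forall>i. approx w i x \<le> 2 * height 0"
  proof
    fix i show "approx w i x \<le> 2 * height 0"
      using approx_tail(2)[OF assms, of 0 i w] height_pos[of i] by simp
  qed
  ultimately have "convergent (\<lambda>i. approx w i x)"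
    by (metis incseq_convergent convergentI)
  then show ?thesis unfolding profile_def by (simp add: convergent_LIMSEQ_iff)
qed

lemma profile_bounds:
  assumes "0 \<le> x"
  shows "approx w i x \<le> profile w x" "profile w x \<le> approx w i x + 2 * height i"
proof -
  have "\<forall>\<^sub>F j in sequentially. approx w i x \<le> approx w j x"
    using approx_tail(1)[OF assms] by (intro eventually_sequentiallyI)
  then show "approx w i x \<le> profile w x"
    by (rule tendsto_lowerbound[OF approx_tendsto[OF assms]]) auto
  have "\<forall>\<^sub>F j in sequentially. approx w j x \<le> approx w i x + 2 * height i"
    using approx_tail(2)[OF assms] height_pos
    by (intro eventually_sequentiallyI[of i]) (smt (verit))
  then show "profile w x \<le> approx w i x + 2 * height i"
    by (rule tendsto_upperbound[OF approx_tendsto[OF assms]]) auto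
qed

lemma profile_lipschitz: "2-lipschitz_on {0..1} (profile w)"
proof (rule lipschitz_onI)
  fix x y :: real assume xy: "x \<in> {0..1}" "y \<in> {0..1}"
  have "(\<lambda>i. dist (approx w i x) (approx w i y)) \<longlonglongrightarrow> dist (profile w x) (profile w y)"
    using xy by (intro tendsto_dist approx_tendsto) auto
  moreover have "dist (approx w i x) (approx w i y) \<le> 2 * dist x y" for i
    using lipschitz_onD[OF tame_lipschitz[OF tame_approx] xy] .
  ultimately show "dist (profile w x) (profile w y) \<le> 2 * dist x y"
    by (intro Lim_bounded) auto
qed auto

text \<open>Up to the first stage \<open>j\<close> in which the decisions differ, both functions agree.  Stage \<open>j\<close>
  then lifts one of them by at least \<open>h\<^sub>j\<close>, and all later stages together add at most
  \<open>2 h\<^sub>j\<^sub>+\<^sub>1\<close>, which is much less.\<close>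
lemma profile_gaps:
  assumes "0 \<le> x"
  shows "profile w x = profile w' x \<or>
    (\<exists>j. height j / 2 \<le> \<bar>profile w x - profile w' x\<bar> \<and> \<bar>profile w x - profile w' x\<bar> \<le> 2 * height j)"
proof (cases "w = w'")
  case False
  then have ex: "\<exists>j. w j \<noteq> w' j" by auto
  define j where "j = (LEAST j. w j \<noteq> w' j)"
  have j: "w j \<noteq> w' j" unfolding j_def using ex by (rule LeastI_ex)
  have eq: "approx w j = approx w' j"
    by (rule approx_cong) (use not_less_Least in \<open>auto simp: j_def\<close>)
  have *: "height j / 2 \<le> profile u x - profile v x \<and> profile u x - profile v x \<le> 2 * height j"
    if "u j" "\<not> v j" "approx u j = approx v j" for u v
    using profile_bounds[OF assms, of u "Suc j"] profile_bounds[OF assms, of v "Suc j"]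
      profile_bounds[OF assms, of u j] profile_bounds[OF assms, of v j]
      bump_bounds[OF assms, of j "approx u j"] height_Suc[of j] height_pos[of j] that
    by (simp add: step_def)
  show ?thesis
    using j *[of w w'] *[of w' w] eq height_pos[of j]
    by (cases "w j") (auto intro!: exI[of _ j] simp: abs_minus_commute[of "profile w x"])
qed auto

section \<open>The porous set\<close>

definition pt :: "real \<Rightarrow> real \<Rightarrow> real^2" where
  "pt x y = vector [x, y]"

definition graph_of :: "(real \<Rightarrow> real) \<Rightarrow> (real^2) set" where
  "graph_of \<phi> = (\<lambda>x. pt x (\<phi> x)) ` {0..1}"

definition fan :: "(real^2) set" where
  "fan = closure (\<Union>w. graph_of (profile w))"

lemma pt_nth [simp]: "pt x y $ 1 = x" "pt x y $ 2 = y"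
  by (simp_all add: pt_def)

lemma pt_eta: "pt (p $ 1) (p $ 2) = p"
  by (simp add: vec_eq_iff forall_2)

lemma dist_pt_le: "dist (pt x y) (pt x' y') \<le> \<bar>x - x'\<bar> + \<bar>y - y'\<bar>"
  using norm_le_l1_cart[of "pt x y - pt x' y'"] by (simp add: dist_norm sum_2)

lemma coords_le_dist: "\<bar>p $ 1 - q $ 1\<bar> \<le> dist p q" "\<bar>p $ 2 - q $ 2\<bar> \<le> dist p q" for p q :: "real^2"
  using component_le_norm_cart[of "p - q"] by (auto simp: dist_norm)

lemma graph_subset_fan: "graph_of (profile w) \<subseteq> fan"
  unfolding fan_def by (rule order_trans[OF _ closure_subset]) auto

lemma finite_length_graph: "finite_length_curve (graph_of (profile w))"
proof -
  have "3-lipschitz_on {0..1} (\<lambda>x. pt x (profile w x))"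
  proof (rule lipschitz_onI)
    fix x y :: real assume "x \<in> {0..1}" "y \<in> {0..1}"
    then show "dist (pt x (profile w x)) (pt y (profile w y)) \<le> 3 * dist x y"
      using lipschitz_onD[OF profile_lipschitz[of w], of x y]
        dist_pt_le[of x "profile w x" y "profile w y"]
      by (simp add: dist_real_def)
  qed auto
  then show ?thesis unfolding finite_length_curve_def graph_of_def by blast
qed

lemma compact_fan: "compact fan"
proof -
  have "norm p \<le> 2" if p: "p \<in> (\<Union>w. graph_of (profile w))" for p
  proof -
    obtain w x where x: "x \<in> {0..1}" "p = pt x (profile w x)"
      using p by (auto simp: graph_of_def)
    have "\<bar>profile w x\<bar> \<le> 1"
      using profile_bounds[of x w 0] angle_le[of 0] x by (auto simp: height_def expo_def)
    moreover have "norm p \<le> \<bar>x\<bar> + \<bar>profile w x\<bar>"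
      using norm_le_l1_cart[of p] x by (simp add: sum_2)
    ultimately show ?thesis using x by simp
  qed
  then show ?thesis
    unfolding fan_def compact_closure bounded_iff by blast
qed

text \<open>Consecutive heights differ by a factor of at least 200, whereas the windows for
  \<open>\<rho> = r\<close> and \<open>\<rho> = r / 16\<close> are disjoint and lie together in \<open>[r / 32, 4 r]\<close>; so they
  cannot both contain a height.\<close>
lemma empty_height_window:
  assumes "0 < r"
  shows "\<exists>\<rho>. \<rho> \<le> r \<and> r \<le> 16 * \<rho> \<and> (\<forall>j. \<not> (\<rho> / 2 \<le> height j \<and> height j \<le> 4 * \<rho>))"
proof (rule ccontr)
  assume no: "\<not> ?thesis"
  have ex: "\<exists>j. \<rho> / 2 \<le> height j \<and> height j \<le> 4 * \<rho>" if "\<rho> \<le> r" "r \<le> 16 * \<rho>" for \<rho>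
    using no that by blast
  obtain i where i: "r / 2 \<le> height i" "height i \<le> 4 * r" using ex[of r] assms by auto
  obtain j where j: "r / 32 \<le> height j" "height j \<le> r / 4" using ex[of "r / 16"] assms by auto
  consider "i < j" | "j < i" | "i = j" by linarith
  then show False
    using i j assms height_separated[of i j] height_separated[of j i] by cases auto
qed

text \<open>Let \<open>\<rho>\<close> be comparable to \<open>r\<close> with no height in \<open>[\<rho> / 2, 4 \<rho>]\<close>.  Then no two
  points of a vertical fibre are between \<open>\<rho>\<close> and \<open>2 \<rho>\<close> apart.  The upper and the lower
  quarter of the vertical interval of radius \<open>\<rho>\<close> around the centre therefore cannot both meet
  the fibre, and the free one is surrounded by a free disc since all functions are 2-Lipschitz.\<close>
lemma porous_fan: "porous fan"
  unfolding porous_def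
proof (intro exI[of _ "1 / 300"] conjI allI impI)
  fix c :: "real^2" and r :: real assume r: "r > 0"
  obtain \<rho> where \<rho>: "\<rho> \<le> r" "r \<le> 16 * \<rho>"
    "\<And>j. \<not> (\<rho> / 2 \<le> height j \<and> height j \<le> 4 * \<rho>)"
    using empty_height_window[OF r] by blast
  \<comment> \<open>the fibre over the point of \<open>[0,1]\<close> closest to the column of \<open>c\<close>\<close>
  define x0 where "x0 = max 0 (min 1 (c $ 1))"
  have x0: "x0 \<in> {0..1}" by (auto simp: x0_def)
  have "\<exists>s\<in>{-1, 1::real}. \<forall>w. \<rho> / 4 < \<bar>profile w x0 - (c $ 2 + s * (3 / 4 * \<rho>))\<bar>"
  proof (rule ccontr)
    assume "\<not> ?thesis"
    then obtain w w' where
      "\<bar>profile w x0 - (c $ 2 - 3 / 4 * \<rho>)\<bar> \<le> \<rho> / 4"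
      "\<bar>profile w' x0 - (c $ 2 + 3 / 4 * \<rho>)\<bar> \<le> \<rho> / 4"
      by (auto simp: not_less)
    then have close: "\<rho> \<le> \<bar>profile w x0 - profile w' x0\<bar>" "\<bar>profile w x0 - profile w' x0\<bar> \<le> 2 * \<rho>"
      unfolding abs_le_iff by argo+
    moreover have "0 < \<rho>" using \<rho>(2) r by simp
    ultimately have "profile w x0 \<noteq> profile w' x0" by auto
    then obtain j where "height j / 2 \<le> \<bar>profile w x0 - profile w' x0\<bar>"
      "\<bar>profile w x0 - profile w' x0\<bar> \<le> 2 * height j"
      using profile_gaps[of x0 w w'] x0 by auto
    then have "height j / 2 \<le> 2 * \<rho>" "\<rho> \<le> 2 * height j"
      using close by linarith+
    then show False using \<rho>(3)[of j] by simp
  qed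
  then obtain s :: real where "s \<in> {-1, 1}"
    and s2: "\<forall>w. \<rho> / 4 < \<bar>profile w x0 - (c $ 2 + s * (3 / 4 * \<rho>))\<bar>" by (rule bexE)
  then have s: "\<bar>s\<bar> = 1" by auto
  define y where "y = pt (c $ 1) (c $ 2 + s * (3 / 4 * \<rho>))"
  have "dist c y \<le> \<bar>s * (3 / 4 * \<rho>)\<bar>"
    using dist_pt_le[of "c $ 1" "c $ 2" "y $ 1" "y $ 2"] by (simp add: y_def pt_eta)
  also have "\<dots> \<le> r" using s \<rho> r by (simp add: abs_mult)
  finally have "y \<in> cball c r" by simp
  moreover have "ball y (\<rho> / 16) \<inter> (\<Union>w. graph_of (profile w)) = {}"
  proof (rule ccontr)
    assume "\<not> ?thesis"
    then obtain p where p: "p \<in> ball y (\<rho> / 16)" "p \<in> (\<Union>w. graph_of (profile w))" by blast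
    then obtain w where "p \<in> graph_of (profile w)" by blast
    then obtain x where x: "x \<in> {0..1}" and "p = pt x (profile w x)"
      unfolding graph_of_def by (rule imageE)
    then have xd: "dist y (pt x (profile w x)) < \<rho> / 16" using p(1) by simp
    have "\<bar>c $ 1 - x\<bar> \<le> \<rho> / 16" "\<bar>y $ 2 - profile w x\<bar> \<le> \<rho> / 16"
      using coords_le_dist[of y "pt x (profile w x)"] xd by (auto simp: y_def)
    moreover have "\<bar>x0 - x\<bar> \<le> \<bar>c $ 1 - x\<bar>" using x by (auto simp: x0_def)
    moreover have "\<bar>profile w x0 - profile w x\<bar> \<le> 2 * \<bar>x0 - x\<bar>"
      using lipschitz_onD[OF profile_lipschitz x0 x] by (simp add: dist_real_def)
    moreover have "0 \<le> \<rho>" using \<rho>(2) r by simp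
    ultimately have "\<bar>profile w x0 - y $ 2\<bar> \<le> \<rho> / 4" by argo
    then show False using spec[OF s2, of w] by (simp add: y_def)
  qed
  then have "ball y (\<rho> / 16) \<inter> fan = {}"
    unfolding fan_def by (subst open_Int_closure_eq_empty) auto
  moreover have "cball y (1 / 300 * r) \<subseteq> ball y (\<rho> / 16)"
    using \<rho> r by (auto simp: subset_iff)
  ultimately show "\<exists>y\<in>cball c r. cball y (1 / 300 * r) \<inter> fan = {}" by blast
qed auto

section \<open>Multiresolution families exist\<close>

lemma net_in_close:
  assumes "net_in \<delta> P N" "0 < \<delta>" "x \<in> P"
  shows "\<exists>z\<in>N. dist x z < \<delta>"
proof (rule ccontr)
  assume no: "\<not> ?thesis"
  then have "x \<notin> N" using assms(2) by auto
  have "separated \<delta> (insert x N)"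
    using no assms by (auto simp: net_in_def separated_def dist_commute not_less)
  then have "insert x N = N" using assms by (auto simp: net_in_def)
  then show False using \<open>x \<notin> N\<close> by auto
qed

lemma net_in_extend:
  assumes "N \<subseteq> P" "separated \<delta> N"
  shows "\<exists>N'. N \<subseteq> N' \<and> net_in \<delta> P N'"
proof -
  let ?A = "{M. N \<subseteq> M \<and> M \<subseteq> P \<and> separated \<delta> M}"
  have "\<exists>M\<in>?A. \<forall>X\<in>?A. M \<subseteq> X \<longrightarrow> X = M"
  proof (rule subset_Zorn_nonempty)
    show "?A \<noteq> {}" using assms by blast
    fix C assume C: "C \<noteq> {}" "subset.chain ?A C"
    have "separated \<delta> (\<Union>C)"
      unfolding separated_def
    proof (intro ballI impI)
      fix x y assume xy: "x \<in> \<Union>C" "y \<in> \<Union>C" "x \<noteq> y"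
      then obtain X Y where XY: "X \<in> C" "Y \<in> C" "x \<in> X" "y \<in> Y" by blast
      then have "X \<subseteq> Y \<or> Y \<subseteq> X" using C(2) by (auto simp: subset_chain_def)
      then obtain Z where "Z \<in> C" "x \<in> Z" "y \<in> Z" using XY by blast
      then show "\<delta> \<le> dist x y"
        using C(2) xy(3) by (auto simp: subset_chain_def separated_def)
    qed
    then show "\<Union>C \<in> ?A" using C by (auto simp: subset_chain_def)
  qed
  then obtain M where M: "M \<in> ?A" "\<forall>X\<in>?A. M \<subseteq> X \<longrightarrow> X = M" by (rule bexE)
  have "X = M" if "M \<subseteq> X" "X \<subseteq> P" "separated \<delta> X" for X
  proof -
    have "X \<in> ?A" using M(1) that by auto
    then show ?thesis using bspec[OF M(2)] that(1) by blast
  qed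
  then have "net_in \<delta> P M" using M(1) by (simp add: net_in_def)
  then show ?thesis using M(1) by blast
qed

text \<open>For scales larger than the diameter a single point is a net.  From there on nets are extended
  to finer ones by Zorn's lemma.\<close>
lemma multiresolution_family_exists:
  assumes "bounded P" "P \<noteq> {}"
  shows "\<exists>F. multiresolution_family P F"
proof -
  obtain p where p: "p \<in> P" using assms by blast
  obtain K :: nat where K: "diameter P < 2 ^ K"
    using real_arch_pow[of 2 "diameter P"] by auto
  have single: "net_in \<delta> P {p}" if "diameter P < \<delta>" for \<delta>
    unfolding net_in_def
  proof (intro conjI allI impI)
    fix X assume X: "{p} \<subseteq> X \<and> X \<subseteq> P \<and> separated \<delta> X"
    have "x = p" if "x \<in> X" for x
    proof (rule ccontr)
      assume "x \<noteq> p"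
      then have "\<delta> \<le> dist x p" using X that unfolding separated_def by blast
      moreover have "dist x p \<le> diameter P"
        using diameter_bounded_bound[OF assms(1), of x p] X that by blast
      ultimately show False using \<open>diameter P < \<delta>\<close> by simp
    qed
    then show "X = {p}" using X by blast
  qed (use p in \<open>auto simp: separated_def\<close>)
  have "\<exists>M. \<forall>n. (net_in (2 powi (K - int n)) P (M n) \<and> (n = 0 \<longrightarrow> M n = {p})) \<and>
      M n \<subseteq> M (Suc n)"
  proof (rule dependent_nat_choice[where P = "\<lambda>n X. net_in (2 powi (K - int n)) P X \<and> (n = 0 \<longrightarrow> X = {p})"
        and Q = "\<lambda>n X Y. X \<subseteq> Y"])
    show "\<exists>X. net_in (2 powi (K - int 0)) P X \<and> (0 = (0::nat) \<longrightarrow> X = {p})"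
      using single[of "2 powi K"] K by (auto simp: power_int_def)
  next
    fix X and n :: nat
    assume X: "net_in (2 powi (K - int n)) P X \<and> (n = 0 \<longrightarrow> X = {p})"
    then have "X \<subseteq> P" by (simp add: net_in_def)
    have "(2::real) powi (K - int (Suc n)) \<le> 2 powi (K - int n)"
      by (intro power_int_increasing) auto
    moreover have "separated (2 powi (K - int n)) X" using X by (simp add: net_in_def)
    ultimately have "separated (2 powi (K - int (Suc n))) X"
      unfolding separated_def by (meson order_trans)
    then show "\<exists>Y. (net_in (2 powi (K - int (Suc n))) P Y \<and> (Suc n = 0 \<longrightarrow> Y = {p})) \<and> X \<subseteq> Y"
      using net_in_extend[of X P "2 powi (K - int (Suc n))"] \<open>X \<subseteq> P\<close> by blast
  qed
  then obtain M where "\<forall>n. (net_in (2 powi (K - int n)) P (M n) \<and> (n = 0 \<longrightarrow> M n = {p})) \<and>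
      M n \<subseteq> M (Suc n)" by (rule exE)
  then have M: "net_in (2 powi (K - int n)) P (M n)" "M 0 = {p}" "M n \<subseteq> M (Suc n)" for n
    by simp_all
  define N where "N k = M (nat (k + K))" for k :: int
  have "net_in (2 powi (- k)) P (N k)" for k :: int
  proof (cases "0 \<le> k + K")
    case True
    then show ?thesis using M(1)[of "nat (k + K)"] by (simp add: N_def)
  next
    case False
    then have "(2::real) powi K \<le> 2 powi (- k)" by (intro power_int_increasing) auto
    then have "diameter P < 2 powi (- k)" using K by simp
    then show ?thesis using single False M(2) by (simp add: N_def)
  qed
  moreover have "N k \<subseteq> N (k + 1)" for k :: int
  proof (cases "0 \<le> k + K")
    case True
    then have "nat (k + 1 + K) = Suc (nat (k + K))" by simp
    then show ?thesis using M(3) by (simp add: N_def)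
  next
    case False
    then show ?thesis by (simp add: N_def)
  qed
  ultimately show ?thesis unfolding multiresolution_family_def by blast
qed

section \<open>Lower bounds for beta numbers\<close>

lemma line_normal:
  assumes "T \<in> lines_through_origin"
  shows "\<exists>v. norm v = 1 \<and> (\<forall>t\<in>T. v \<bullet> t = 0)"
proof -
  have "dim T < DIM(real^2)" using assms by (simp add: lines_through_origin_def)
  from lowdim_subset_hyperplane[OF this]
  obtain a where a: "a \<noteq> 0" "span T \<subseteq> {x. a \<bullet> x = 0}" by (elim exE conjE)
  then have "a \<bullet> t = 0" if "t \<in> T" for t
    using that span_base[of t T] by blast
  then have "\<forall>t\<in>T. sgn a \<bullet> t = 0" by (simp add: sgn_div_norm)
  then show ?thesis using a(1) by (intro exI[of _ "sgn a"]) (simp add: norm_sgn)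
qed

text \<open>The distance to a line is the distance in the direction of its normal \<open>v\<close>.  All admissible
  lines have the same normal, so no choice among them can be close to two points whose
  components along \<open>v\<close> are far apart: the larger of the two distances is at least half of the
  difference.\<close>
lemma beta_lower_bound:
  assumes T: "\<forall>t\<in>\<tau> D. v \<bullet> t = 0" and v: "norm v = 1"
    and x: "x \<in> \<Gamma>" "x \<in> points D" and y: "y \<in> \<Gamma>" "y \<in> points D"
    and c: "c \<le> \<bar>v \<bullet> (x - y)\<bar>" and D: "0 < snd D"
  shows "ennreal (c / (4 * snd D)) \<le> beta \<tau> \<Gamma> D"
proof -
  have "ennreal (c / 2) \<le> (SUP p\<in>\<Gamma> \<inter> points D. ennreal (infdist p L))"
    if L: "L \<in> lines_parallel_to (\<tau> D)" for L
  proof -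
    obtain a where a: "\<tau> D = (\<lambda>z. a + z) ` L"
      using L by (auto simp: lines_parallel_to_def affine_parallel_def)
    have "L \<noteq> {}" using L by (auto simp: lines_parallel_to_def)
    \<comment> \<open>\<open>v\<close> is constant on \<open>L\<close>, with value \<open>- (v \<bullet> a)\<close>\<close>
    have *: "\<bar>v \<bullet> p + v \<bullet> a\<bar> \<le> infdist p L" for p
      unfolding infdist_notempty[OF \<open>L \<noteq> {}\<close>]
    proof (rule cINF_greatest[OF \<open>L \<noteq> {}\<close>])
      fix z assume "z \<in> L"
      then have "v \<bullet> (a + z) = 0" using T a by blast
      then have "v \<bullet> p + v \<bullet> a = v \<bullet> (p - z)" by (simp add: inner_simps)
      also have "\<bar>\<dots>\<bar> \<le> norm v * norm (p - z)" by (rule Cauchy_Schwarz_ineq2)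
      finally show "\<bar>v \<bullet> p + v \<bullet> a\<bar> \<le> dist p z" using v by (simp add: dist_norm)
    qed
    have "c \<le> infdist x L + infdist y L"
      using *[of x] *[of y] c by (simp add: inner_simps)
    then consider "c / 2 \<le> infdist x L" | "c / 2 \<le> infdist y L" by linarith
    then show ?thesis
    proof cases
      case 1
      then show ?thesis using x by (intro SUP_upper2[of x]) (auto intro: ennreal_leI)
    next
      case 2
      then show ?thesis using y by (intro SUP_upper2[of y]) (auto intro: ennreal_leI)
    qed
  qed
  then have "ennreal (c / 2) \<le>
      (INF L\<in>lines_parallel_to (\<tau> D). SUP p\<in>\<Gamma> \<inter> points D. ennreal (infdist p L))"
    by (intro INF_greatest)
  then have "ennreal (c / 2) / ennreal (diameter (points D)) \<le> beta \<tau> \<Gamma> D"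
    unfolding beta_def by (rule divide_right_mono_ennreal)
  moreover have "ennreal (c / (4 * snd D)) \<le> ennreal (c / 2) / ennreal (diameter (points D))"
  proof (cases "0 \<le> c")
    case True
    then show ?thesis using D by (simp add: points_def divide_ennreal)
  next
    case False
    then have "c / (4 * snd D) \<le> 0" using D by (simp add: divide_nonpos_pos)
    then show ?thesis by (simp add: ennreal_neg)
  qed
  ultimately show ?thesis by (rule order_trans[rotated])
qed

text \<open>The ambiguity that every line field suffers from: a unit normal \<open>v\<close> cannot be nearly
  orthogonal to both \<open>(1, s)\<close> and \<open>(1, s + t)\<close>.  If the second component of \<open>v\<close> is not
  small, then the two products differ by a multiple of \<open>t\<close>; if it is small, then \<open>v\<close> is almost
  horizontal and not orthogonal to any vector of slope at most 1.\<close>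
lemma slope_ambiguity:
  fixes v :: "real^2"
  assumes "norm v = 1" "\<bar>s\<bar> \<le> 1" "0 < t" "t \<le> 1"
  shows "t / 6 \<le> \<bar>v $ 1 + s * v $ 2\<bar> \<or> t / 6 \<le> \<bar>v $ 1 + (s + t) * v $ 2\<bar>"
proof (cases "1 / 3 \<le> \<bar>v $ 2\<bar>")
  case True
  have "t * (1 / 3) \<le> t * \<bar>v $ 2\<bar>" using True assms by (intro mult_left_mono) auto
  also have "\<dots> = \<bar>(v $ 1 + (s + t) * v $ 2) - (v $ 1 + s * v $ 2)\<bar>"
    using assms by (simp add: algebra_simps abs_mult)
  finally show ?thesis by linarith
next
  case False
  have "(v $ 1)\<^sup>2 + (v $ 2)\<^sup>2 = 1"
    using assms(1) by (simp add: norm_vec_def L2_set_def sum_2)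
  moreover have "(v $ 2)\<^sup>2 \<le> (1 / 3)\<^sup>2" using False by (subst abs_le_square_iff[symmetric]) auto
  ultimately have "(1 / 2)\<^sup>2 \<le> (v $ 1)\<^sup>2" by (simp add: power2_eq_square)
  then have "1 / 2 \<le> \<bar>v $ 1\<bar>" by (subst (asm) abs_le_square_iff[symmetric]) auto
  moreover have "\<bar>s * v $ 2\<bar> \<le> 1 * (1 / 3)"
    unfolding abs_mult using assms False by (intro mult_mono) auto
  ultimately have "1 / 6 \<le> \<bar>v $ 1 + s * v $ 2\<bar>" by linarith
  then show ?thesis using assms by simp
qed

section \<open>The decision of one stage\<close>

text \<open>Deciding against bending in all stages from \<open>i\<close> on leaves the function unchanged.  So the
  finite approximations have their graphs in the set, and net points can be chosen near these
  graphs before stage \<open>i\<close> is decided.\<close>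
lemma approx_is_profile:
  obtains w' where "\<And>x. 0 \<le> x \<Longrightarrow> profile w' x = approx w i x"
proof
  fix x :: real assume x: "0 \<le> x"
  define w' where "w' = (\<lambda>j. j < i \<and> w j)"
  have "approx w' j x = approx w i x" if "i \<le> j" for j
    using that
  proof (induction j rule: dec_induct)
    case base
    show ?case using approx_cong[of i w' w] by (simp add: w'_def)
  next
    case (step j)
    then show ?case by (simp add: w'_def step_def)
  qed
  then have "\<forall>\<^sub>F j in sequentially. approx w' j x = approx w i x"
    by (intro eventually_sequentiallyI)
  then have "(\<lambda>j. approx w' j x) \<longlonglongrightarrow> approx w i x"
    by (rule tendsto_eventually)
  then have "profile w' x = approx w i x"
    using LIMSEQ_unique approx_tendsto[OF x] by blast
  then show "profile (\<lambda>j. j < i \<and> w j) x = approx w i x" by (simp add: w'_def)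
qed

lemma heavier_option:
  assumes "finite T" "\<And>t. t \<in> T \<Longrightarrow> Q False t \<or> Q True t" "\<And>t. t \<in> T \<Longrightarrow> 0 \<le> (f t :: real)"
  shows "\<exists>b. sum f T / 2 \<le> sum f {t \<in> T. Q b t}"
proof -
  have "sum f T \<le> (\<Sum>t\<in>T. (if Q False t then f t else 0) + (if Q True t then f t else 0))"
    using assms by (intro sum_mono) fastforce
  also have "\<dots> = sum f {t \<in> T. Q False t} + sum f {t \<in> T. Q True t}"
    using assms(1) by (simp add: sum.distrib sum.inter_filter)
  finally have "sum f T / 2 \<le> sum f {t \<in> T. Q False t} \<or> sum f T / 2 \<le> sum f {t \<in> T. Q True t}"
    by linarith
  then show ?thesis by blast
qed

lemma many_gentle_cells:
  assumes "tame n e \<phi>" "e \<le> 1 / 4"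
  obtains \<sigma> where "has_slopes n \<phi> \<sigma>" "3 / 4 * 2 ^ n \<le> real (card {q. q < 2 ^ n \<and> \<bar>\<sigma> q\<bar> \<le> 1})"
proof -
  obtain \<sigma> where \<sigma>: "has_slopes n \<phi> \<sigma>" "(\<Sum>q<2 ^ n. (\<sigma> q)\<^sup>2) \<le> e * 2 ^ n"
    using assms(1) by (auto simp: tame_def)
  have "(\<Sum>q<2 ^ n. if \<bar>\<sigma> q\<bar> \<le> 1 then 0 else 1) \<le> (\<Sum>q<2 ^ n. (\<sigma> q)\<^sup>2)"
  proof (rule sum_mono)
    fix q
    have "1 \<le> (\<sigma> q)\<^sup>2" if "1 < \<bar>\<sigma> q\<bar>"
      using power_mono[of 1 "\<bar>\<sigma> q\<bar>" 2] that by simp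
    then show "(if \<bar>\<sigma> q\<bar> \<le> 1 then 0 else 1) \<le> (\<sigma> q)\<^sup>2" by auto
  qed
  also note \<sigma>(2)
  also have "e * 2 ^ n \<le> 1 / 4 * 2 ^ n" by (intro mult_right_mono assms(2)) simp
  finally have steep: "(\<Sum>q<2 ^ n. if \<bar>\<sigma> q\<bar> \<le> 1 then 0 else 1::real) \<le> 1 / 4 * 2 ^ n" .
  have "(\<Sum>q<2 ^ n. if \<bar>\<sigma> q\<bar> \<le> 1 then 0 else 1::real) + (\<Sum>q<2 ^ n. if \<bar>\<sigma> q\<bar> \<le> 1 then 1 else 0)
      = (\<Sum>q\<in>{..<2 ^ n :: nat}. 1)"
    unfolding sum.distrib[symmetric] by (intro sum.cong) auto
  moreover have "(\<Sum>q<2 ^ n. if \<bar>\<sigma> q\<bar> \<le> 1 then 1 else 0)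
      = real (card {q. q < 2 ^ n \<and> \<bar>\<sigma> q\<bar> \<le> 1})"
    by (subst sum.inter_filter[symmetric]) auto
  ultimately show ?thesis using that[OF \<sigma>(1)] steep by simp
qed

text \<open>At all scales of stage \<open>i\<close> both options, with all their continuations, stay within one scale
  unit of the common approximation.\<close>
lemma smallest_scale:
  assumes "k < expo i + 3 + lvl i"
  shows "6 * height i \<le> 1 / 2 ^ k"
proof -
  have "(2::real) ^ k \<le> 2 ^ (expo i + 2 + lvl i)"
    using assms by (intro power_increasing) auto
  then have "6 * height i * 2 ^ k \<le> 6 * height i * 2 ^ (expo i + 2 + lvl i)"
    using height_pos[of i] by (intro mult_left_mono) auto
  also have "\<dots> = 24 * (angle i * 2 ^ lvl i)" by (simp add: height_def power_add)
  also have "\<dots> \<le> 1" using angle_mult_pow[of i] by simp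
  finally show ?thesis by (simp add: field_simps)
qed

lemma slope_first_half:
  assumes \<sigma>: "has_slopes (expo i) \<phi> \<sigma>" and q: "q < 2 ^ expo i" "\<bar>\<sigma> q\<bar> \<le> 1"
    and x: "q / 2 ^ expo i \<le> x" "x \<le> y" "y \<le> (q + 1 / 2) / 2 ^ expo i"
  shows "step i b \<phi> y - step i b \<phi> x = (\<sigma> q + (if b then angle i else 0)) * (y - x)"
proof -
  have "(q + 1 / 2) / 2 ^ expo i \<le> (real q + 1) / 2 ^ expo i"
    by (intro divide_right_mono) auto
  then have cell: "x \<in> cell (expo i) q" "y \<in> cell (expo i) q"
    using x by (auto simp: cell_def add.commute)
  have half: "(real q + 1) / 2 ^ expo i = 2 * ((q + 1 / 2) / 2 ^ expo i) - q / 2 ^ expo i"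
    by (simp add: field_simps)
  have min: "min (z - q / 2 ^ expo i) ((real q + 1) / 2 ^ expo i - z) = z - q / 2 ^ expo i"
    if "z \<le> (q + 1 / 2) / 2 ^ expo i" for z
    unfolding half using that by (intro min_absorb1) linarith
  show ?thesis
    using has_slopesD[OF \<sigma> q(1) cell(1)] has_slopesD[OF \<sigma> q(1) cell(2)]
      bump_on_cell[OF \<sigma> q(1) cell(1)] bump_on_cell[OF \<sigma> q(1) cell(2)] q(2) x min[of x] min[of y]
    by (simp add: step_def algebra_simps)
qed

text \<open>The abscissa of the \<open>j\<close>-th test point of scale \<open>2 ^ (- k)\<close> in the cell \<open>q\<close>.  Test points
  are four units of scale apart, so that balls centred within one unit of the graph above them
  are distinct.  For \<open>j < 2 ^ (k - n - 3)\<close> they exhaust the left half of the cell, where a tent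
  has constant slope.\<close>
definition probe :: "nat \<Rightarrow> nat \<Rightarrow> nat \<Rightarrow> nat \<Rightarrow> real" where
  "probe n k q j = q / 2 ^ n + 4 * j / 2 ^ k"

lemma pow_split:
  assumes "n + 3 \<le> k"
  shows "(2::real) ^ k = 2 ^ n * 8 * 2 ^ (k - n - 3)"
proof -
  obtain d where "k = n + 3 + d" using assms by (auto simp: le_iff_add)
  then show ?thesis by (simp add: power_add)
qed

lemma probe_in_first_half:
  assumes "n + 3 \<le> k" "j < 2 ^ (k - n - 3)"
  shows "q / 2 ^ n \<le> probe n k q j" "probe n k q j + 1 / 2 ^ k \<le> (q + 1 / 2) / 2 ^ n"
proof -
  show "q / 2 ^ n \<le> probe n k q j" by (simp add: probe_def)
  define M :: nat where "M = 2 ^ (k - n - 3)"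
  have k: "(2::real) ^ k = 8 * 2 ^ n * M"
    using pow_split[OF assms(1)] by (simp add: M_def)
  have "j < M" using assms(2) by (simp only: M_def)
  then have "4 * real j + 1 \<le> 4 * real M" by linarith
  moreover have "0 < real M" by (simp add: M_def)
  ultimately have "(4 * real j + 1) / (8 * 2 ^ n * M) \<le> 4 * real M / (8 * 2 ^ n * M)"
    by (intro divide_right_mono) auto
  also have "\<dots> = 1 / 2 / 2 ^ n" using \<open>0 < real M\<close> by simp
  finally have "(4 * real j + 1) / (8 * 2 ^ n * M) \<le> 1 / 2 / 2 ^ n" .
  then show "probe n k q j + 1 / 2 ^ k \<le> (q + 1 / 2) / 2 ^ n"
    unfolding probe_def k add_divide_distrib by simp
qed

lemma probe_separated:
  assumes k: "n + 3 \<le> k" and j: "j < 2 ^ (k - n - 3)" "j' < 2 ^ (k - n - 3)"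
    and close: "\<bar>probe n k q j - probe n k q' j'\<bar> < 4 / 2 ^ k"
  shows "q = q' \<and> j = j'"
proof -
  define M :: nat where "M = 2 ^ (k - n - 3)"
  have kM: "(2::real) ^ k = 2 ^ n * 8 * M"
    using pow_split[OF k] by (simp add: M_def)
  have M: "0 < real M" "0 < M" by (simp_all add: M_def)
  have probe: "probe n k r i = 4 * real (2 * M * r + i) / 2 ^ k" for r i
    unfolding probe_def kM using M by (simp add: field_simps)
  have "\<bar>real (2 * M * q + j) - real (2 * M * q' + j')\<bar> < 1"
    using close unfolding probe by (simp add: field_simps abs_mult flip: diff_divide_distrib)
  then have eq: "2 * M * q + j = 2 * M * q' + j'" by linarith
  have "j < 2 * M" "j' < 2 * M" using j by (auto simp: M_def)
  then have "(2 * M * q + j) div (2 * M) = q" "(2 * M * q' + j') div (2 * M) = q'"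
    by simp_all
  then show ?thesis using eq by auto
qed

text \<open>\<open>S\<close> is a set of balls of total radius at least a multiple of \<open>lvl i\<close> in which every curve that
  takes the option \<open>b\<close> after \<open>\<phi>\<close> has a large beta number, whatever it decides later.\<close>
definition costly ::
    "disc set \<Rightarrow> (disc \<Rightarrow> (real^2) set) \<Rightarrow> nat \<Rightarrow> (real \<Rightarrow> real) \<Rightarrow> bool \<Rightarrow> disc set \<Rightarrow> bool" where
  "costly F \<tau> i \<phi> b S \<longleftrightarrow> finite S \<and> S \<subseteq> F \<and>
     (\<forall>B\<in>S. \<exists>k\<in>{expo i + 3..<expo i + 3 + lvl i}. snd B = 2 / 2 ^ k) \<and>
     3 / 32 * lvl i \<le> sum snd S \<and>
     (\<forall>w. approx w (Suc i) = step i b \<phi> \<longrightarrow>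
       (\<forall>B\<in>S. graph_of (profile w) \<inter> points B \<noteq> {} \<and>
         ennreal (angle i / 384) \<le> beta \<tau> (graph_of (profile w)) (dilate 4 B)))"

text \<open>
  Every triple \<open>t\<close> of a scale, a gentle cell and a test point determines a ball \<open>B t\<close> of the
  family; it is chosen before the decision and is met by all curves that continue \<open>approx w i\<close>.
  The triple is bad for an option if the line attached to \<open>B t\<close> is wrong for the slope that
  this option produces above the test point.  Each triple is bad for at least one option, so one
  option is responsible for half of the total radius.  A curve that takes it passes over the test
  point \<open>x\<close> and over \<open>x + r\<close>, where \<open>r\<close> is the scale, and the two points of the curve there
  show the slope up to an error that comes from later stages and is only half of what the wrong
  direction costs.
\<close>
lemma stage_choice:
  fixes N :: "int \<Rightarrow> (real^2) set"
  assumes N: "\<And>k. net_in (2 powi (- k)) fan (N k)"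
    and F: "F = {(z, 2 * 2 powi (- k)) | z k. z \<in> N k}"
    and \<tau>: "coarse_line_field (dilate 4 ` F) \<tau>"
  shows "\<exists>b S. costly F \<tau> i (approx w i) b S"
proof -
  define n where "n = expo i"
  define \<phi> where "\<phi> = approx w i"
  obtain \<sigma> where \<sigma>: "has_slopes n \<phi> \<sigma>"
    and gentle: "3 / 4 * 2 ^ n \<le> real (card {q. q < 2 ^ n \<and> \<bar>\<sigma> q\<bar> \<le> 1})"
    using many_gentle_cells[OF tame_approx sum_angle_sq_le] unfolding n_def \<phi>_def by metis
  define Q where "Q = {q. q < 2 ^ n \<and> \<bar>\<sigma> q\<bar> \<le> 1}"
  define I where "I = (SIGMA k:{n + 3..<n + 3 + lvl i}. Q \<times> {..<2 ^ (k - n - 3) :: nat})"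
  define X where "X = (\<lambda>(k, q, j). probe n k q j)"
  have fin: "finite Q" "finite I" by (auto simp: Q_def I_def)
  have I: "n + 3 \<le> fst t" "fst t < n + 3 + lvl i" "fst (snd t) < 2 ^ n" "\<bar>\<sigma> (fst (snd t))\<bar> \<le> 1"
    "snd (snd t) < 2 ^ (fst t - n - 3)" if "t \<in> I" for t
    using that by (auto simp: I_def Q_def)
  have half: "real (fst (snd t)) / 2 ^ n \<le> X t" "X t + 1 / 2 ^ fst t \<le> (real (fst (snd t)) + 1 / 2) / 2 ^ n"
    if "t \<in> I" for t
    using probe_in_first_half[of n "fst t" "snd (snd t)" "fst (snd t)"] I[OF that]
    by (auto simp: X_def case_prod_beta)
  have X01: "0 \<le> X t" "X t + 1 / 2 ^ fst t \<le> 1" "X t \<le> 1" if "t \<in> I" for t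
  proof -
    have "0 \<le> real (fst (snd t)) / (2::real) ^ n" by simp
    then show "0 \<le> X t" using half(1)[OF that] by linarith
    have "real (fst (snd t)) + 1 \<le> real (2 ^ n)" using I(3)[OF that] by linarith
    then have "(real (fst (snd t)) + 1 / 2) / (2::real) ^ n \<le> 1" by simp
    then show le: "X t + 1 / 2 ^ fst t \<le> 1" using half(2)[OF that] by linarith
    have "0 \<le> 1 / (2::real) ^ fst t" by simp
    then show "X t \<le> 1" using le by linarith
  qed
  have "\<exists>z\<in>N (int (fst t)). dist (pt (X t) (\<phi> (X t))) z < 1 / 2 ^ fst t" if tI: "t \<in> I" for t
  proof -
    obtain w0 where "profile w0 (X t) = \<phi> (X t)"
      using approx_is_profile[of w i] X01(1)[OF tI] unfolding \<phi>_def by metis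
    then have "pt (X t) (\<phi> (X t)) \<in> graph_of (profile w0)"
      using X01[OF tI] unfolding graph_of_def by (intro image_eqI[of _ _ "X t"]) auto
    then have "pt (X t) (\<phi> (X t)) \<in> fan" using graph_subset_fan by blast
    from net_in_close[OF N _ this, of "int (fst t)"]
    show ?thesis by (simp add: power_int_minus field_simps)
  qed
  then obtain Z where Z: "\<And>t. t \<in> I \<Longrightarrow> Z t \<in> N (int (fst t))"
    "\<And>t. t \<in> I \<Longrightarrow> dist (pt (X t) (\<phi> (X t))) (Z t) < 1 / 2 ^ fst t"
    by metis
  define B where "B t = (Z t, 2 / 2 ^ fst t :: real)" for t :: "nat \<times> nat \<times> nat"
  have BF: "B t \<in> F" if "t \<in> I" for t
    unfolding F B_def using Z(1)[OF that]
    by (auto intro!: exI[of _ "int (fst t)"] simp: power_int_minus field_simps)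
  have inj: "inj_on B I"
  proof (rule inj_onI)
    fix s t assume st: "s \<in> I" "t \<in> I" "B s = B t"
    then have k: "fst s = fst t" and "Z s = Z t" by (auto simp: B_def)
    have "\<bar>X s - X t\<bar> \<le> dist (pt (X s) (\<phi> (X s))) (pt (X t) (\<phi> (X t)))"
      using coords_le_dist(1)[of "pt (X s) (\<phi> (X s))" "pt (X t) (\<phi> (X t))"] by simp
    also have "\<dots> < 2 / 2 ^ fst t"
      using dist_triangle2[of "pt (X s) (\<phi> (X s))" "pt (X t) (\<phi> (X t))" "Z t"]
        Z(2)[OF st(1)] Z(2)[OF st(2)] k \<open>Z s = Z t\<close> by simp
    also have "\<dots> \<le> 4 / 2 ^ fst t" by (intro divide_right_mono) auto
    finally have "\<bar>X s - X t\<bar> < 4 / 2 ^ fst t" .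
    then show "s = t"
      using probe_separated[of n "fst t" "snd (snd s)" "snd (snd t)" "fst (snd s)" "fst (snd t)"]
        I[OF st(1)] I[OF st(2)] k
      by (simp add: X_def case_prod_beta prod_eq_iff)
  qed
  have "\<exists>v. norm v = 1 \<and> (\<forall>p\<in>\<tau> (dilate 4 (B t)). v \<bullet> p = 0)" if "t \<in> I" for t
    using line_normal \<tau> BF[OF that] unfolding coarse_line_field_def by blast
  then obtain V where V: "\<And>t. t \<in> I \<Longrightarrow> norm (V t) = 1"
    "\<And>t. t \<in> I \<Longrightarrow> \<forall>p\<in>\<tau> (dilate 4 (B t)). V t \<bullet> p = 0"
    by metis
  define bad where "bad b t \<longleftrightarrow>
    angle i / 6 \<le> \<bar>V t $ 1 + (\<sigma> (fst (snd t)) + (if b then angle i else 0)) * V t $ 2\<bar>" for b t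
  have "\<exists>b. (\<Sum>t\<in>I. 2 / 2 ^ fst t) / 2 \<le> (\<Sum>t\<in>{t\<in>I. bad b t}. 2 / 2 ^ fst t :: real)"
  proof (rule heavier_option)
    fix t assume "t \<in> I"
    then show "bad False t \<or> bad True t"
      unfolding bad_def using slope_ambiguity[of "V t" "\<sigma> (fst (snd t))" "angle i"]
        V(1) I(4) angle_pos[of i] angle_le[of i] by simp
  qed (use fin in auto)
  then obtain b where b: "(\<Sum>t\<in>I. 2 / 2 ^ fst t) / 2 \<le> (\<Sum>t\<in>{t\<in>I. bad b t}. 2 / 2 ^ fst t :: real)" ..
  define S where "S = B ` {t\<in>I. bad b t}"
  have "(\<Sum>t\<in>I. 2 / 2 ^ fst t :: real)
      = (\<Sum>k\<in>{n + 3..<n + 3 + lvl i}. \<Sum>p\<in>Q \<times> {..<2 ^ (k - n - 3) :: nat}. 2 / 2 ^ k)"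
    unfolding I_def by (subst sum.Sigma) (auto simp: fin intro!: sum.cong)
  also have "\<dots> = (\<Sum>k\<in>{n + 3..<n + 3 + lvl i}. card Q / (4 * 2 ^ n))"
  proof (intro sum.cong refl)
    fix k assume "k \<in> {n + 3..<n + 3 + lvl i}"
    then have "(2::real) ^ k = 2 ^ n * 8 * 2 ^ (k - n - 3)" by (intro pow_split) auto
    then show "(\<Sum>p\<in>Q \<times> {..<2 ^ (k - n - 3) :: nat}. 2 / 2 ^ k) = card Q / (4 * (2::real) ^ n)"
      by (simp add: card_cartesian_product)
  qed
  also have "\<dots> = lvl i * (card Q / (4 * 2 ^ n))" by simp
  also have "\<dots> \<ge> lvl i * (3 / 16)"
    using gentle by (intro mult_left_mono) (auto simp: Q_def[symmetric] field_simps)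
  finally have "3 / 32 * lvl i \<le> (\<Sum>t\<in>{t\<in>I. bad b t}. 2 / 2 ^ fst t :: real)"
    using b by simp
  also have "\<dots> = sum snd S"
    unfolding S_def using inj
    by (subst sum.reindex) (auto simp: B_def intro: inj_on_subset)
  finally have mass: "3 / 32 * lvl i \<le> sum snd S" .
  have "graph_of (profile w') \<inter> points D \<noteq> {} \<and>
        ennreal (angle i / 384) \<le> beta \<tau> (graph_of (profile w')) (dilate 4 D)"
    if w': "approx w' (Suc i) = step i b (approx w i)" and D: "D \<in> S" for w' D
  proof -
    obtain t where t: "t \<in> I" "bad b t" "D = B t" using D by (auto simp: S_def)
    define r :: real where "r = 1 / 2 ^ fst t"
    define x where "x = X t"
    define f where "f = profile w'"
    define s where "s = \<sigma> (fst (snd t)) + (if b then angle i else 0)"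
    have r: "0 < r" "6 * height i \<le> r"
      using smallest_scale[of "fst t" i] I(2)[OF t(1)] by (auto simp: r_def n_def)
    have x: "0 \<le> x" "x + r \<le> 1" using X01[OF t(1)] by (auto simp: x_def r_def)
    have \<psi>: "step i b \<phi> y \<le> f y" "f y \<le> step i b \<phi> y + 2 * height (Suc i)" if "0 \<le> y" for y
      using profile_bounds[OF that, of w' "Suc i"] unfolding w' \<phi>_def[symmetric] f_def by auto
    have near: "\<bar>f x - \<phi> x\<bar> \<le> r"
      using \<psi>[OF x(1)] bump_bounds[OF x(1), of i \<phi>] height_pos[of i] height_Suc[of i] r
      by (auto simp: step_def split: if_splits)
    have lip: "\<bar>f (x + r) - f x\<bar> \<le> 2 * r"
      using lipschitz_onD[OF profile_lipschitz[of w'], of "x + r" x] x r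
      by (simp add: f_def dist_real_def)
    define p where "p = pt x (f x)"
    define p' where "p' = pt (x + r) (f (x + r))"
    have zp: "dist (Z t) p \<le> 2 * r"
    proof -
      have "dist p (pt x (\<phi> x)) \<le> r" using dist_pt_le[of x "f x" x "\<phi> x"] near by (simp add: p_def)
      moreover have "dist (pt x (\<phi> x)) (Z t) < r" using Z(2)[OF t(1)] by (simp add: x_def r_def)
      ultimately show ?thesis using dist_triangle[of p "Z t" "pt x (\<phi> x)"] by (simp add: dist_commute)
    qed
    moreover have "dist p p' \<le> 3 * r"
      using dist_pt_le[of x "f x" "x + r" "f (x + r)"] lip r
      by (simp add: p_def p'_def abs_minus_commute)
    ultimately have zp': "dist (Z t) p' \<le> 5 * r" using dist_triangle[of "Z t" p' p] by simp
    have graph: "p \<in> graph_of f" "p' \<in> graph_of f"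
      unfolding p_def p'_def graph_of_def using x r by (auto intro!: imageI)
    have B: "fst D = Z t" "snd D = 2 * r" using t(3) by (auto simp: B_def r_def)
    have pD: "p \<in> points D" using zp by (simp add: points_def B)
    have dil: "p \<in> points (dilate 4 D)" "p' \<in> points (dilate 4 D)" "snd (dilate 4 D) = 8 * r"
      using zp zp' r by (auto simp: points_def dilate_def B)
    have "step i b \<phi> (x + r) - step i b \<phi> x = s * r"
      using slope_first_half[of i \<phi> \<sigma> "fst (snd t)" x "x + r" b] \<sigma> I[OF t(1)] half[OF t(1)] r
      by (simp add: n_def x_def r_def s_def)
    then have rise: "\<bar>f (x + r) - f x - s * r\<bar> \<le> 2 * height (Suc i)"
      using \<psi>[of x] \<psi>[of "x + r"] x r by auto
    have "angle i * (6 * height i) \<le> angle i * r"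
      using r angle_pos[of i] by (intro mult_left_mono) auto
    moreover have "height (Suc i) \<le> angle i * height i / 200"
      using height_Suc_le[of i] by (simp add: height_def[of i] power2_eq_square)
    moreover have "0 \<le> angle i * height i" using angle_pos[of i] height_pos[of i] by simp
    \<comment> \<open>the direction error costs \<open>\<theta> r / 6\<close>, and the later stages give back at most half of it\<close>
    ultimately have tail: "2 * height (Suc i) \<le> angle i * r / 12" by linarith
    have "\<bar>V t $ 2\<bar> \<le> 1" using component_le_norm_cart[of "V t" 2] V(1)[OF t(1)] by simp
    then have err: "\<bar>V t $ 2 * (f (x + r) - f x - s * r)\<bar> \<le> 1 * (angle i * r / 12)"
      unfolding abs_mult using rise tail by (intro mult_mono) auto
    have "angle i / 6 * r \<le> \<bar>V t $ 1 + s * V t $ 2\<bar> * r"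
      using t(2) r unfolding bad_def s_def by (intro mult_right_mono) auto
    also have "\<dots> = \<bar>r * V t $ 1 + s * r * V t $ 2\<bar>"
    proof -
      have "r * V t $ 1 + s * r * V t $ 2 = (V t $ 1 + s * V t $ 2) * r" by (simp add: algebra_simps)
      then show ?thesis using r by (simp add: abs_mult)
    qed
    finally have main: "angle i * r / 6 \<le> \<bar>r * V t $ 1 + s * r * V t $ 2\<bar>" by simp
    have "V t \<bullet> (p' - p) = r * V t $ 1 + s * r * V t $ 2 + V t $ 2 * (f (x + r) - f x - s * r)"
      by (simp add: inner_vec_def sum_2 p_def p'_def algebra_simps)
    then have wide: "angle i * r / 12 \<le> \<bar>V t \<bullet> (p' - p)\<bar>" using main err by linarith
    have "ennreal (angle i * r / 12 / (4 * snd (dilate 4 D))) \<le> beta \<tau> (graph_of f) (dilate 4 D)"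
      using V[OF t(1), folded t(3)] r
      by (intro beta_lower_bound[OF _ _ graph(2) dil(2) graph(1) dil(1) wide]) (simp_all add: dil(3))
    then have "ennreal (angle i * r / 12 / (4 * (8 * r))) \<le> beta \<tau> (graph_of f) (dilate 4 D)"
      using dil(3) by simp
    moreover have "angle i * r / 12 / (4 * (8 * r)) = angle i / 384" using r by simp
    ultimately have "ennreal (angle i / 384) \<le> beta \<tau> (graph_of f) (dilate 4 D)" by (simp only:)
    then show ?thesis using graph(1) pD unfolding f_def by blast
  qed
  moreover have "\<forall>D\<in>S. \<exists>k\<in>{expo i + 3..<expo i + 3 + lvl i}. snd D = 2 / 2 ^ k"
    using I(1,2) by (auto simp: S_def B_def n_def)
  moreover have "finite S" "S \<subseteq> F" using fin BF by (auto simp: S_def)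
  ultimately show ?thesis using mass unfolding costly_def
    by (intro exI[of _ b] exI[of _ S]) auto
qed

section \<open>Curves with infinite sums\<close>

lemma costly_path:
  fixes N :: "int \<Rightarrow> (real^2) set"
  assumes N: "\<And>k. net_in (2 powi (- k)) fan (N k)"
    and F: "F = {(z, 2 * 2 powi (- k)) | z k. z \<in> N k}"
    and \<tau>: "coarse_line_field (dilate 4 ` F) \<tau>"
  obtains w S where "\<And>i. costly F \<tau> i (approx w i) (w i) (S i)"
proof -
  \<comment> \<open>the recursion runs over the current function, since all earlier decisions are visible in it\<close>
  have "\<exists>\<phi>. \<forall>i. (\<exists>w. \<phi> i = approx w i) \<and>
      (\<exists>b. \<phi> (Suc i) = step i b (\<phi> i) \<and> (\<exists>S. costly F \<tau> i (\<phi> i) b S))"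
  proof (rule dependent_nat_choice[where P = "\<lambda>i \<phi>. \<exists>w. \<phi> = approx w i"
        and Q = "\<lambda>i \<phi> \<phi>'. \<exists>b. \<phi>' = step i b \<phi> \<and> (\<exists>S. costly F \<tau> i \<phi> b S)"])
    show "\<exists>\<phi> w. \<phi> = approx w 0" by simp
  next
    fix \<phi> i assume "\<exists>w. \<phi> = approx w i"
    then obtain w where w: "\<phi> = approx w i" ..
    obtain b S where b: "costly F \<tau> i \<phi> b S"
      using stage_choice[OF N F \<tau>, of i w] unfolding w by blast
    have "approx (w(i := b)) (Suc i) = step i b \<phi>"
      using approx_cong[of i "w(i := b)" w] by (simp add: w)
    then show "\<exists>\<phi>'. (\<exists>w. \<phi>' = approx w (Suc i)) \<and> (\<exists>b. \<phi>' = step i b \<phi> \<and> (\<exists>S. costly F \<tau> i \<phi> b S))"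
      using b by metis
  qed
  then obtain \<phi> where \<phi>: "\<And>i. \<exists>w. \<phi> i = approx w i"
    "\<And>i. \<exists>b. \<phi> (Suc i) = step i b (\<phi> i) \<and> (\<exists>S. costly F \<tau> i (\<phi> i) b S)" by metis
  then obtain w S where w: "\<And>i. \<phi> (Suc i) = step i (w i) (\<phi> i)" "\<And>i. costly F \<tau> i (\<phi> i) (w i) (S i)"
    by metis
  have "approx w i = \<phi> i" for i
  proof (induction i)
    case 0
    show ?case using \<phi>(1)[of 0] by auto
  next
    case (Suc i)
    then show ?case using w(1) by simp
  qed
  then show ?thesis using that[of w S] w(2) by simp
qed

text \<open>The constant is \<open>2 (3 / 32) / 384\<^sup>2\<close>, where \<open>\<beta> \<ge> \<theta> / 384\<close>, the total radius of the
  balls is at least \<open>3 lvl i / 32\<close>, and the diameter is twice the radius.\<close>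
lemma costly_stage_sum:
  assumes "costly F \<tau> i (approx w i) (w i) S"
  shows "ennreal (1 / 786432 * (lvl i * (angle i)\<^sup>2))
    \<le> (\<Sum>B\<in>S. (beta \<tau> (graph_of (profile w)) (dilate 4 B))\<^sup>2 * ennreal (diameter (points B)))"
proof -
  have S: "finite S" "3 / 32 * lvl i \<le> sum snd S"
    and pos: "\<And>B. B \<in> S \<Longrightarrow> 0 < snd B"
    and beta: "\<And>B. B \<in> S \<Longrightarrow> ennreal (angle i / 384) \<le> beta \<tau> (graph_of (profile w)) (dilate 4 B)"
    using assms by (fastforce simp: costly_def)+
  have "1 / 786432 * (lvl i * (angle i)\<^sup>2) = (angle i / 384)\<^sup>2 * 2 * (3 / 32 * lvl i)"
    by (simp add: power2_eq_square)
  also have "\<dots> \<le> (angle i / 384)\<^sup>2 * 2 * sum snd S"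
    using S(2) by (intro mult_left_mono) auto
  also have "\<dots> = (\<Sum>B\<in>S. (angle i / 384)\<^sup>2 * (2 * snd B))"
    by (simp add: sum_distrib_left mult.assoc)
  finally have "ennreal (1 / 786432 * (lvl i * (angle i)\<^sup>2))
      \<le> ennreal (\<Sum>B\<in>S. (angle i / 384)\<^sup>2 * (2 * snd B))" by (rule ennreal_leI)
  also have "\<dots> = (\<Sum>B\<in>S. ennreal ((angle i / 384)\<^sup>2 * (2 * snd B)))"
    using pos by (intro sum_ennreal[symmetric]) (auto simp: less_imp_le)
  also have "\<dots> \<le> (\<Sum>B\<in>S. (beta \<tau> (graph_of (profile w)) (dilate 4 B))\<^sup>2 * ennreal (diameter (points B)))"
  proof (rule sum_mono)
    fix B assume B: "B \<in> S"
    have "ennreal ((angle i / 384)\<^sup>2 * (2 * snd B)) = (ennreal (angle i / 384))\<^sup>2 * ennreal (2 * snd B)"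
      using angle_pos[of i] pos[OF B] by (subst ennreal_mult) (auto simp: ennreal_power)
    also have "\<dots> \<le> (beta \<tau> (graph_of (profile w)) (dilate 4 B))\<^sup>2 * ennreal (2 * snd B)"
      using beta[OF B] by (intro mult_right_mono power_mono) auto
    also have "ennreal (2 * snd B) = ennreal (diameter (points B))"
      using pos[OF B] by (simp add: points_def)
    finally show "ennreal ((angle i / 384)\<^sup>2 * (2 * snd B))
      \<le> (beta \<tau> (graph_of (profile w)) (dilate 4 B))\<^sup>2 * ennreal (diameter (points B))" .
  qed
  finally show ?thesis .
qed

lemma costly_disjoint:
  assumes "costly F \<tau> i \<phi> b S" "costly F \<tau> j \<phi>' b' S'" "i < j"
  shows "S \<inter> S' = {}"
proof (rule ccontr)
  assume "\<not> ?thesis"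
  then obtain B where "B \<in> S" "B \<in> S'" by blast
  then obtain k k' where k: "k < expo i + 3 + lvl i" "expo j + 3 \<le> k'"
      "snd B = 2 / 2 ^ k" "snd B = 2 / 2 ^ k'"
    using assms(1,2) by (fastforce simp: costly_def)
  then have "(2::real) ^ k = 2 ^ k'" by (simp add: field_simps)
  then have "k = k'" by simp
  then show False using k scale_ranges_disjoint[OF assms(3)] by simp
qed

theorem theorem1p19:
  "\<exists>(P :: (real^2) set) (F :: disc set) (A :: real).
     compact P \<and> porous P \<and> multiresolution_family P F \<and> A \<ge> 1 \<and>
     (\<forall>\<tau>. coarse_line_field (dilate A ` F) \<tau> \<longrightarrow>
        (\<exists>\<Gamma>. finite_length_curve \<Gamma> \<and> \<Gamma> \<subseteq> P \<and>
           (\<Sum>\<^sub>\<infinity>B\<in>{B \<in> F. \<Gamma> \<inter> points B \<noteq> {}}.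
              (beta \<tau> \<Gamma> (dilate A B))\<^sup>2 * ennreal (diameter (points B))) = \<infinity>))"
proof -
  have "fan \<noteq> {}" using graph_subset_fan by (fastforce simp: graph_of_def)
  then obtain F where F: "multiresolution_family fan F"
    using multiresolution_family_exists compact_imp_bounded[OF compact_fan] by blast
  then obtain N :: "int \<Rightarrow> (real^2) set" where N: "\<And>k. net_in (2 powi (- k)) fan (N k)"
    "F = {(z, 2 * 2 powi (- k)) | z k. z \<in> N k}"
    unfolding multiresolution_family_def by blast
  have "\<exists>\<Gamma>. finite_length_curve \<Gamma> \<and> \<Gamma> \<subseteq> fan \<and>
      (\<Sum>\<^sub>\<infinity>B\<in>{B \<in> F. \<Gamma> \<inter> points B \<noteq> {}}.
        (beta \<tau> \<Gamma> (dilate 4 B))\<^sup>2 * ennreal (diameter (points B))) = \<infinity>"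
    if \<tau>: "coarse_line_field (dilate 4 ` F) \<tau>" for \<tau>
  proof -
    obtain w S where S: "\<And>i. costly F \<tau> i (approx w i) (w i) (S i)"
      using costly_path[OF N \<tau>] by blast
    define \<Gamma> where "\<Gamma> = graph_of (profile w)"
    define g where "g B = (beta \<tau> \<Gamma> (dilate 4 B))\<^sup>2 * ennreal (diameter (points B))" for B
    define total where "total = (\<Sum>\<^sub>\<infinity>B\<in>{B \<in> F. \<Gamma> \<inter> points B \<noteq> {}}. g B)"
    have sub: "S i \<subseteq> {B \<in> F. \<Gamma> \<inter> points B \<noteq> {}}" "finite (S i)" for i
      using S[of i] by (auto simp: costly_def \<Gamma>_def)
    have partial: "ennreal (1 / 786432 * (\<Sum>i<n. lvl i * (angle i)\<^sup>2)) \<le> total" for n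
    proof -
      have "ennreal (1 / 786432 * (\<Sum>i<n. lvl i * (angle i)\<^sup>2))
          = (\<Sum>i<n. ennreal (1 / 786432 * (lvl i * (angle i)\<^sup>2)))"
        by (subst sum_ennreal) (auto simp: sum_distrib_left)
      also have "\<dots> \<le> (\<Sum>i<n. sum g (S i))"
        using costly_stage_sum[OF S] by (intro sum_mono) (simp add: g_def \<Gamma>_def)
      also have "\<dots> = sum g (\<Union>i<n. S i)"
      proof (rule sum.UNION_disjoint[symmetric])
        show "\<forall>i\<in>{..<n}. \<forall>j\<in>{..<n}. i \<noteq> j \<longrightarrow> S i \<inter> S j = {}"
          using costly_disjoint[OF S S] by (metis inf_commute nat_neq_iff)
      qed (use sub in auto)
      also have "\<dots> = infsum g (\<Union>i<n. S i)" using sub by simp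
      also have "\<dots> \<le> total"
        unfolding total_def using sub
        by (intro infsum_mono_neutral nonneg_summable_on_complete) auto
      finally show ?thesis .
    qed
    have "total = \<infinity>"
    proof (rule ccontr)
      assume "total \<noteq> \<infinity>"
      then obtain c where c: "total = ennreal c" "0 \<le> c" by (cases total) auto
      obtain n where "786432 * (c + 1) \<le> (\<Sum>i<n. lvl i * (angle i)\<^sup>2)"
        using sum_lvl_angle_sq_unbounded by blast
      then have "ennreal (c + 1) \<le> ennreal (1 / 786432 * (\<Sum>i<n. lvl i * (angle i)\<^sup>2))"
        by (intro ennreal_leI) simp
      also note partial
      finally show False using c by simp
    qed
    then show ?thesis
      unfolding total_def g_def \<Gamma>_def
      using finite_length_graph graph_subset_fan by blast
  qed
  then show ?thesis
    using compact_fan porous_fan F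
    by (intro exI[of _ fan] exI[of _ F] exI[of _ 4]) auto
qed

end
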